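(* For every $\epsilon > 0$ there exists a Radon probability measure $\mu$ on $\mathbb{R}^2$ supported on $[0,1]^2$ with the following properties: (1) $J_{1,\mu}(x) \leq \epsilon$ for all $x \in \operatorname{spt}\mu$, where $$J_{1,\mu}(x) := \sum_{Q \in \mathcal{D},\ \ell(Q) \leq 1} \beta_{2,\mu}(3Q)^2\, \frac{\ell(Q)}{\mu(Q)}\, 1_Q(x);$$ (2) $\Theta^1_*(\mu,x) := \liminf_{r \to 0} \frac{\mu(B(x,r))}{2r} = 0$ for $\mu$-a.e. $x$. In particular, $\mu$ is purely $1$-unrectifiable, i.e. $\mu(f(\mathbb{R})) = 0$ for every Lipschitz map $f\colon \mathbb{R} \to \mathbb{R}^2$.
   Context: $\mathcal{D}$ is the standard dyadic grid in $\mathbb{R}^2$: all half-open squares $[k2^{-j},(k+1)2^{-j}) \times [l2^{-j},(l+1)2^{-j})$ with $j,k,l \in \mathbb{Z}$. $\ell(Q)$ is the side-length of $Q$, and $3Q$ is the square with the same centre as $Q$ dilated by a factor of three, i.e. the union of $Q$ with its eight dyadic neighbours of the same side-length. $B(x,r)$ is the open ball of radius $r$ centred at $x$. $\operatorname{spt}\mu$ is the (closed) support of $\mu$. For a Radon measure $\mu$ on $\mathbb{R}^2$ and a square $Q \subset \mathbb{R}^2$ with $\mu(Q) > 0$, $$\beta_{2,\mu}(Q) = \inf_L \left[ \frac{1}{\mu(Q)} \int_Q \left( \frac{d(y,L)}{\operatorname{diam}(Q)} \right)^2 d\mu(y) \right]^{1/2},$$ where the infimum is over all affine lines $L \subset \mathbb{R}^2$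 and $d(y,L)$ is the Euclidean distance from $y$ to $L$. *)

theory Defs
  imports "HOL-Analysis.Analysis" "HOL-Probability.Probability"
begin

definition radon_measure :: "'a::t2_space measure \<Rightarrow> bool" where
  "radon_measure M \<longleftrightarrow>
     sets M = sets borel \<and>
     (\<forall>K. compact K \<longrightarrow> emeasure M K < \<infinity>) \<and>
     (\<forall>U. open U \<longrightarrow> emeasure M U = (SUP K\<in>{K. compact K \<and> K \<subseteq> U}. emeasure M K)) \<and>
     (\<forall>A\<in>sets borel. emeasure M A = (INF U\<in>{U. open U \<and> A \<subseteq> U}. emeasure M U))"

definition spt :: "'a::topological_space measure \<Rightarrow> 'a set" where
  "spt M = - \<Union>{U. open U \<and> emeasure M U = 0}"

definition half_open_square :: "real^2 \<Rightarrow> real \<Rightarrow> (real^2) set" where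
  "half_open_square a s = {x. \<forall>i. a $ i \<le> x $ i \<and> x $ i < a $ i + s}"

definition dyadic_squares :: "(real^2) set set" where
  "dyadic_squares =
     {half_open_square (vector [of_int k * 2 powi (-j), of_int l * 2 powi (-j)]) (2 powi (-j))
       | j k l :: int. True}"

definition side_length :: "(real^2) set \<Rightarrow> real" where
  "side_length Q = (THE s. s > 0 \<and> (\<exists>a. Q = half_open_square a s))"

definition centre :: "(real^2) set \<Rightarrow> real^2" where
  "centre Q = (THE c. \<exists>a s. s > 0 \<and> Q = half_open_square a s \<and> c = (\<chi> i. a $ i + s / 2))"

definition triple :: "(real^2) set \<Rightarrow> (real^2) set" where
  "triple Q = (\<lambda>x. centre Q + 3 *\<^sub>R (x - centre Q)) ` Q"

lemma half_open_square_inject: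
  assumes s: "s > 0" and t: "t > 0" and eq: "half_open_square a s = half_open_square b t"
  shows "a = b" "s = t"
proof -
  have "a \<in> half_open_square a s" "b \<in> half_open_square b t"
    using s t by (auto simp: half_open_square_def)
  then have "a \<in> half_open_square b t" "b \<in> half_open_square a s"
    using eq by auto
  then show ab: "a = b"
    by (auto simp: half_open_square_def vec_eq_iff intro: order_antisym)
  have le: "u \<le> v" if "u > 0" "v > 0" "half_open_square a u = half_open_square a v" for u v
  proof (rule ccontr)
    assume "\<not> u \<le> v"
    then have "(\<chi> i. a $ i + v) \<in> half_open_square a u"
      using that(1,2) by (simp add: half_open_square_def)
    moreover have "(\<chi> i. a $ i + v) \<notin> half_open_square a v"
      by (auto simp: half_open_square_def)
    ultimately show False using that by auto
  qed
  show "s = t"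
    using le[of s t] le[of t s] s t eq ab by auto
qed

lemma side_length_half_open_square [simp]:
  "s > 0 \<Longrightarrow> side_length (half_open_square a s) = s"
  unfolding side_length_def by (rule the_equality) (auto dest: half_open_square_inject)

lemma centre_half_open_square [simp]:
  assumes "s > 0"
  shows "centre (half_open_square a s) = (\<chi> i. a $ i + s / 2)"
  unfolding centre_def
proof (rule the_equality)
  fix c
  assume "\<exists>b t. t > 0 \<and> half_open_square a s = half_open_square b t \<and> c = (\<chi> i. b $ i + t / 2)"
  then show "c = (\<chi> i. a $ i + s / 2)"
    using half_open_square_inject[OF assms] by metis
qed (use assms in auto)

lemma triple_half_open_square:
  assumes s: "s > 0"
  shows "triple (half_open_square a s) = half_open_square (\<chi> i. a $ i - s) (3 * s)"
proof -
  let ?c = "\<chi> i. a $ i + s / 2"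
  have "x \<in> (\<lambda>x. ?c + 3 *\<^sub>R (x - ?c)) ` half_open_square a s"
    if x: "x \<in> half_open_square (\<chi> i. a $ i - s) (3 * s)" for x
  proof (rule image_eqI)
    show "x = ?c + 3 *\<^sub>R ((?c + (1/3) *\<^sub>R (x - ?c)) - ?c)"
      by (simp add: vec_eq_iff)
    have "a $ i \<le> a $ i + s / 2 + (x $ i - (a $ i + s / 2)) / 3 \<and>
          a $ i + s / 2 + (x $ i - (a $ i + s / 2)) / 3 < a $ i + s" for i
    proof -
      have "a $ i - s \<le> x $ i" "x $ i < a $ i - s + 3 * s"
        using x by (auto simp: half_open_square_def)
      then show ?thesis by (simp add: field_simps)
    qed
    then show "?c + (1/3) *\<^sub>R (x - ?c) \<in> half_open_square a s"
      by (simp add: half_open_square_def)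
  qed
  moreover have "?c + 3 *\<^sub>R (x - ?c) \<in> half_open_square (\<chi> i. a $ i - s) (3 * s)"
    if x: "x \<in> half_open_square a s" for x
  proof -
    have "a $ i - s \<le> a $ i + s / 2 + 3 * (x $ i - (a $ i + s / 2)) \<and>
          a $ i + s / 2 + 3 * (x $ i - (a $ i + s / 2)) < a $ i - s + 3 * s" for i
    proof -
      have "a $ i \<le> x $ i" "x $ i < a $ i + s"
        using x by (auto simp: half_open_square_def)
      then show ?thesis by (simp add: field_simps)
    qed
    then show ?thesis by (simp add: half_open_square_def)
  qed
  ultimately show ?thesis
    unfolding triple_def centre_half_open_square[OF s] by blast
qed

definition affine_lines :: "(real^2) set set" where
  "affine_lines = {L. affine L \<and> aff_dim L = 1}"

definition beta2 :: "(real^2) measure \<Rightarrow> (real^2) set \<Rightarrow> real" where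
  "beta2 M Q = (INF L\<in>affine_lines.
     sqrt (1 / measure M Q * (LINT y:Q|M. (infdist y L / diameter Q)\<^sup>2)))"

text \<open>
  The sum is taken in \<open>[0, \<infinity>]\<close>. In \<^typ>\<open>ennreal\<close>, \<open>a / 0 = \<infinity>\<close> for \<open>a > 0\<close> and
  \<open>0 * \<infinity> = 0\<close>, so a square \<open>Q \<ni> x\<close> with \<open>\<mu>(Q) = 0\<close> contributes \<open>\<infinity>\<close> unless
  \<open>\<beta>(3Q) = 0\<close>, and squares not containing \<open>x\<close> contribute \<open>0\<close>.
\<close>

definition jones1 :: "(real^2) measure \<Rightarrow> real^2 \<Rightarrow> ennreal" where
  "jones1 M x = (\<Sum>\<^sub>\<infinity>Q\<in>{Q \<in> dyadic_squares. side_length Q \<le> 1}.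
     ennreal ((beta2 M (triple Q))\<^sup>2) * (ennreal (side_length Q) / emeasure M Q) * indicator Q x)"

definition lower_density1 :: "(real^2) measure \<Rightarrow> real^2 \<Rightarrow> ennreal" where
  "lower_density1 M x = Liminf (at_right 0) (\<lambda>r. emeasure M (ball x r) / ennreal (2 * r))"

definition purely_1_unrectifiable :: "(real^2) measure \<Rightarrow> bool" where
  "purely_1_unrectifiable M \<longleftrightarrow>
     (\<forall>f :: real \<Rightarrow> real^2. (\<exists>C. C-lipschitz_on UNIV f) \<longrightarrow> emeasure M (range f) = 0)"

end

theory Submission imports Defs begin

text \<open>
  The measure is a homogeneous Cantor measure. A square of generation \<open>b\<close>, of side \<open>r\<close> and mass
  \<open>2\<^sup>b\<^sup>+\<^sup>1 r\<close>, is replaced by tiny squares (the next generation) placed along horizontal lines: half of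
  its mass goes uniformly to the bottom edge, the centre row, which thus has linear density \<open>2\<^sup>b\<close>, and
  the other half goes to \<open>4\<^sup>b\<close> satellite rows at the lacunary heights \<open>4\<^sup>-\<^sup>i r\<close>, each of linear density
  only \<open>2\<^sup>-\<^sup>b\<close>. Concentrating mass on a line costs nothing in the Jones function, so the density can
  be raised again to \<open>2\<^sup>b\<^sup>+\<^sup>2\<close> inside the tiny squares.

  At the scale of its height, a satellite is seen next to the much heavier centre row, so that
  \<open>\<beta>\<^sup>2 \<lesssim> 2\<^sup>-\<^sup>b / 2\<^sup>b\<close>, and the weight \<open>\<ell>(Q)/\<mu>(Q) = 2\<^sup>b\<close> produces a contribution \<open>\<lesssim> 2\<^sup>-\<^sup>b\<close>. A square
  meeting the centre row contributes \<open>\<lesssim> 2\<^sup>-\<^sup>b / (2\<^sup>b 2\<^sup>b)\<close>, and there are about \<open>4\<^sup>b\<close> such scales. At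
  smaller scales only one row is visible. Hence generation \<open>b\<close> contributes \<open>\<lesssim> 2\<^sup>-\<^sup>b\<close>, which is
  summable. On the other hand a point lies in a satellite with probability one half in each generation,
  independently, so almost every point does so infinitely often and sees densities \<open>\<lesssim> 2\<^sup>-\<^sup>b\<close>.
\<close>

section \<open>Radon measures, lower density and rectifiability\<close>

lemma finite_borel_measure_radon:
  fixes M :: "'a::{polish_space,heine_borel} measure"
  assumes sb: "sets M = sets borel" and fin: "finite_measure M"
  shows "radon_measure M"
proof -
  have ne: "emeasure M (space M) \<noteq> \<infinity>"
    using fin by (simp add: finite_measure.emeasure_finite)
  have "emeasure M U = (SUP K\<in>{K. compact K \<and> K \<subseteq> U}. emeasure M K)" if "open U" for U
    using inner_regular[OF sb ne, of U] that by (simp add: conj_commute)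
  moreover have "emeasure M A = (INF U\<in>{U. open U \<and> A \<subseteq> U}. emeasure M U)" if "A \<in> sets borel" for A
    using outer_regular[OF sb ne that] by (simp add: conj_commute)
  moreover have "emeasure M K < \<infinity>" for K
    using finite_measure.emeasure_finite[OF fin, of K] by (simp add: less_top)
  ultimately show ?thesis
    unfolding radon_measure_def using sb by blast
qed

text \<open>The indicator of the union is at most the sum of the indicators; integrating and
  exchanging the integrals gives the bound. The index set is any countable set and overlaps are
  allowed, as the Vitali cover below requires.\<close>

lemma emeasure_UN_countable_le:
  assumes [measurable]: "\<And>i. i \<in> I \<Longrightarrow> X i \<in> sets M" and [simp]: "countable I"
  shows "emeasure M (\<Union>(X ` I)) \<le> (\<integral>\<^sup>+i. emeasure M (X i) \<partial>count_space I)"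
proof -
  have le: "indicator (\<Union>(X ` I)) x \<le> (\<integral>\<^sup>+i. indicator (X i) x \<partial>count_space I)" for x
  proof (cases "x \<in> \<Union>(X ` I)")
    case True
    then obtain j where j: "j \<in> I" "x \<in> X j" by auto
    have "(1::ennreal) = (\<integral>\<^sup>+i. indicator {j} i \<partial>count_space I)"
      using j by (subst nn_integral_indicator) auto
    also have "\<dots> \<le> (\<integral>\<^sup>+i. indicator (X i) x \<partial>count_space I)"
      using j by (intro nn_integral_mono) (auto split: split_indicator)
    finally show ?thesis using True by simp
  qed simp
  have [measurable]: "\<Union>(X ` I) \<in> sets M" by (intro sets.countable_UN') auto
  have "emeasure M (\<Union>(X ` I)) = (\<integral>\<^sup>+x. indicator (\<Union>(X ` I)) x \<partial>M)" by simp
  also have "\<dots> \<le> (\<integral>\<^sup>+x. \<integral>\<^sup>+i. indicator (X i) x \<partial>count_space I \<partial>M)"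
    by (intro nn_integral_mono le)
  also have "\<dots> = (\<integral>\<^sup>+i. \<integral>\<^sup>+x. indicator (X i) x \<partial>M \<partial>count_space I)"
    by (subst nn_integral_count_space_nn_integral) auto
  also have "\<dots> = (\<integral>\<^sup>+i. emeasure M (X i) \<partial>count_space I)"
    by (intro nn_integral_cong) auto
  finally show ?thesis .
qed

text \<open>A failure would keep the quotient above \<open>l / 2\<close> for all radii below
  \<open>e\<close>, and hence the lower limit as well.\<close>

lemma lower_density1_zero_small_balls:
  assumes "lower_density1 M x = 0" and "e > 0" and "l > 0"
  shows "\<exists>r. 0 < r \<and> r < e \<and> emeasure M (ball x r) \<le> ennreal (l * r)"
proof (rule ccontr)
  assume "\<not> ?thesis"
  then have neg: "ennreal (l * r) < emeasure M (ball x r)" if "0 < r" "r < e" for r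
    using that by (meson not_le_imp_less)
  have "ennreal (l / 2) \<le> lower_density1 M x"
    unfolding lower_density1_def
  proof (rule Liminf_bounded)
    show "\<forall>\<^sub>F r in at_right 0. ennreal (l / 2) \<le> emeasure M (ball x r) / ennreal (2 * r)"
      unfolding eventually_at_right_field
    proof (intro exI[of _ e] conjI allI impI)
      fix r :: real assume r: "0 < r" "r < e"
      have "ennreal (l / 2) = ennreal (l * r) / ennreal (2 * r)"
        using r assms by (simp add: divide_ennreal)
      also have "\<dots> \<le> emeasure M (ball x r) / ennreal (2 * r)"
        using neg[OF r] by (intro divide_right_mono_ennreal) simp
      finally show "ennreal (l / 2) \<le> emeasure M (ball x r) / ennreal (2 * r)" .
    qed (use assms in auto)
  qed
  with assms show False by (simp add: ennreal_eq_0_iff)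
qed

text \<open>A Vitali covering in the parameter interval: the balls around \<open>f t\<close> of small \<open>M\<close>-mass
  have preimages containing intervals of comparable length.\<close>

lemma lower_density1_zero_imp_lipschitz_arc_null:
  fixes f :: "real \<Rightarrow> real^2"
  assumes sb: "sets M = sets borel"
    and AE: "AE x in M. lower_density1 M x = 0"
    and lip: "C-lipschitz_on UNIV f" and T: "T > 0"
  shows "emeasure M (f ` {-T..T}) = 0"
proof -
  define L where "L = max C 1"
  have L: "L > 0" "\<And>s t. dist (f s) (f t) \<le> L * dist s t"
  proof -
    show "L > 0" by (simp add: L_def)
    fix s t
    have "dist (f s) (f t) \<le> C * dist s t" using lip by (auto simp: lipschitz_on_def)
    also have "\<dots> \<le> L * dist s t" by (intro mult_right_mono) (auto simp: L_def)
    finally show "dist (f s) (f t) \<le> L * dist s t" .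
  qed
  obtain N where N: "N \<in> null_sets M" "{x\<in>space M. lower_density1 M x \<noteq> 0} \<subseteq> N"
    using AE by (auto elim!: AE_E simp: null_sets_def)
  have spM: "space M = UNIV" using sets_eq_imp_space_eq[OF sb] by simp
  define E where "E = {t \<in> {-T..T}. f t \<notin> N}"
  have main: "emeasure M (f ` {-T..T}) \<le> ennreal (5 * L * l * (T + 1))" if l: "l > 0" for l
  proof -
    have "\<exists>r. 0 < r \<and> r < 5 * L \<and> emeasure M (ball (f t) r) \<le> ennreal (l * r)" if "t \<in> E" for t
    proof -
      have "lower_density1 M (f t) = 0" using that N(2) spM by (auto simp: E_def)
      then show ?thesis
        using L l by (intro lower_density1_zero_small_balls) auto
    qed
    then obtain \<rho> where \<rho>: "\<And>t. t \<in> E \<Longrightarrow> 0 < \<rho> t \<and> \<rho> t < 5 * L \<and> emeasure M (ball (f t) (\<rho> t)) \<le> ennreal (l * \<rho> t)"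
      by metis
    \<comment> \<open>The factor 5 anticipates the enlargement in the Vitali lemma: \<open>f\<close>
      maps the interval of radius \<open>5 * q t\<close> into the ball of radius
      \<open>\<rho> t\<close>. The bound \<open>\<rho> t < 5 * L\<close> gives
      \<open>q t \<le> 1\<close>, which confines the intervals to
      \<open>{-(T+1)..T+1}\<close>.\<close>
    define q where "q t = \<rho> t / (5 * L)" for t
    have q: "0 < q t \<and> q t \<le> 1" if "t \<in> E" for t
      using \<rho>[OF that] L by (auto simp: q_def field_simps)
    have "E \<subseteq> (\<Union>t\<in>E. ball t (q t))" using q by force
    then obtain D where D: "countable D" "D \<subseteq> E"
        "pairwise (\<lambda>i j. disjnt (ball i (q i)) (ball j (q j))) D"
        "E \<subseteq> (\<Union>i\<in>D. ball i (5 * q i))"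
      using Vitali_covering_lemma_balls[where S = E and K = E and a = "\<lambda>t. t" and r = q and B = 1] q by auto
    have sub: "f ` {-T..T} \<subseteq> N \<union> (\<Union>i\<in>D. ball (f i) (\<rho> i))"
    proof
      fix x assume "x \<in> f ` {-T..T}"
      then obtain t where t: "t \<in> {-T..T}" "x = f t" by auto
      show "x \<in> N \<union> (\<Union>i\<in>D. ball (f i) (\<rho> i))"
      proof (cases "x \<in> N")
        case False
        then have "t \<in> E" using t by (auto simp: E_def)
        then obtain i where i: "i \<in> D" "dist i t < 5 * q i" using D(4) by auto
        have "dist (f i) (f t) \<le> L * dist i t" by (rule L)
        also have "\<dots> < L * (5 * q i)" using i L by simp
        also have "\<dots> = \<rho> i" using L by (simp add: q_def)
        finally show ?thesis using i t by auto
      qed auto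
    qed
    have mb: "(\<Union>i\<in>D. ball (f i) (\<rho> i)) \<in> sets M" using sb by (auto intro!: borel_open)
    have Ns: "N \<in> sets M" using N by auto
    have "emeasure M (f ` {-T..T}) \<le> emeasure M (N \<union> (\<Union>i\<in>D. ball (f i) (\<rho> i)))"
      using sub mb Ns by (intro emeasure_mono) auto
    also have "\<dots> = emeasure M (\<Union>i\<in>D. ball (f i) (\<rho> i))"
      using N(1) mb by (subst Un_commute) (rule emeasure_Un_null_set)
    also have "\<dots> \<le> (\<integral>\<^sup>+i. emeasure M (ball (f i) (\<rho> i)) \<partial>count_space D)"
      using D(1) sb by (intro emeasure_UN_countable_le) (auto intro!: borel_open)
    \<comment> \<open>Each ball has mass at most \<open>l * \<rho> i = 5 * L * l * q i\<close>,
      which is \<open>5 * L * l / 2\<close> times the length \<open>2 * q i\<close> of its parameter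
      interval. The intervals are disjoint, so their lengths add up to at most
      \<open>2 * (T + 1)\<close>.\<close>
    also have "\<dots> \<le> (\<integral>\<^sup>+i. ennreal (5 * L * l / 2) * emeasure lborel (ball i (q i)) \<partial>count_space D)"
    proof (rule nn_integral_mono)
      fix i assume "i \<in> space (count_space D)"
      then have i: "i \<in> E" using D by auto
      have "ball i (q i) = {i - q i<..<i + q i}" by (auto simp: ball_def dist_real_def abs_less_iff)
      then have "emeasure lborel (ball i (q i)) = ennreal (2 * q i)" using q[OF i] by simp
      then have "ennreal (5 * L * l / 2) * emeasure lborel (ball i (q i)) = ennreal (l * \<rho> i)"
        using L l q[OF i] by (simp flip: ennreal_mult add: q_def)
      then show "emeasure M (ball (f i) (\<rho> i)) \<le> ennreal (5 * L * l / 2) * emeasure lborel (ball i (q i))"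
        using \<rho>[OF i] by simp
    qed
    also have "\<dots> = ennreal (5 * L * l / 2) * (\<integral>\<^sup>+i. emeasure lborel (ball i (q i)) \<partial>count_space D)"
      by (rule nn_integral_cmult) simp
    also have "(\<integral>\<^sup>+i. emeasure lborel (ball i (q i)) \<partial>count_space D) = emeasure lborel (\<Union>i\<in>D. ball i (q i))"
      using D(1,3) by (intro emeasure_UN_countable[symmetric])
        (auto simp: disjoint_family_on_def pairwise_def disjnt_def)
    also have "ennreal (5 * L * l / 2) * emeasure lborel (\<Union>i\<in>D. ball i (q i))
        \<le> ennreal (5 * L * l / 2) * emeasure lborel {-(T+1)..T+1}"
    proof (intro mult_left_mono emeasure_mono)
      show "(\<Union>i\<in>D. ball i (q i)) \<subseteq> {-(T+1)..T+1}"
      proof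
        fix s assume "s \<in> (\<Union>i\<in>D. ball i (q i))"
        then obtain i where i: "i \<in> E" "dist i s < q i" using D by auto
        with q[OF i(1)] show "s \<in> {-(T+1)..T+1}" by (auto simp: E_def dist_real_def)
      qed
    qed auto
    also have "emeasure lborel {-(T+1)..T+1} = ennreal (2 * (T + 1))"
      using T by (subst emeasure_lborel_Icc) auto
    also have "ennreal (5 * L * l / 2) * ennreal (2 * (T + 1)) = ennreal (5 * L * l * (T + 1))"
      using L l T by (subst ennreal_mult[symmetric]) auto
    finally show ?thesis .
  qed
  show ?thesis
  proof (rule ccontr)
    assume nz: "emeasure M (f ` {-T..T}) \<noteq> 0"
    have "emeasure M (f ` {-T..T}) < top" using main[of 1] by (simp add: le_less_trans)
    then obtain c where c: "emeasure M (f ` {-T..T}) = ennreal c" "c \<ge> 0"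
      by (cases "emeasure M (f ` {-T..T})") auto
    then have "c > 0" using nz by (cases "c = 0") auto
    \<comment> \<open>Chosen so that the bound \<open>main\<close> becomes half of the supposed mass
      \<open>c\<close>.\<close>
    define l where "l = c / (10 * L * (T + 1))"
    have "l > 0" using \<open>c > 0\<close> L T by (simp add: l_def)
    from main[OF this] have "c \<le> 5 * L * l * (T + 1)"
      using c L T \<open>l > 0\<close> by simp
    also have "\<dots> = c / 2"
    proof -
      have "L \<noteq> 0" "T + 1 \<noteq> 0" using L T by auto
      then show ?thesis by (simp add: l_def divide_simps)
    qed
    finally show False using \<open>c > 0\<close> by simp
  qed
qed

lemma lower_density1_zero_imp_purely_1_unrectifiable:
  assumes sb: "sets M = sets borel"
    and AE: "AE x in M. lower_density1 M x = 0"
  shows "purely_1_unrectifiable M"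
  unfolding purely_1_unrectifiable_def
proof (intro allI impI)
  fix f :: "real \<Rightarrow> real^2" assume "\<exists>C. C-lipschitz_on UNIV f"
  then obtain C where lip: "C-lipschitz_on UNIV f" by auto
  have contf: "continuous_on UNIV f" using lip by (rule lipschitz_on_continuous_on)
  have rng: "range f = (\<Union>n::nat. f ` {-(real n + 1)..real n + 1})"
  proof
    show "range f \<subseteq> (\<Union>n::nat. f ` {-(real n + 1)..real n + 1})"
    proof
      fix x assume "x \<in> range f"
      then obtain t where t: "x = f t" by auto
      obtain n :: nat where "\<bar>t\<bar> \<le> real n" using real_arch_simple by blast
      then have "t \<in> {-(real n + 1)..real n + 1}" by auto
      then show "x \<in> (\<Union>n::nat. f ` {-(real n + 1)..real n + 1})" using t by blast
    qed
  qed auto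
  have "f ` {-(real n + 1)..real n + 1} \<in> null_sets M" for n
  proof -
    have "compact (f ` {-(real n + 1)..real n + 1})"
      by (intro compact_continuous_image continuous_on_subset[OF contf]) auto
    then show ?thesis
      using lower_density1_zero_imp_lipschitz_arc_null[OF sb AE lip, of "real n + 1"] sb
      by (simp add: null_sets_def borel_compact)
  qed
  then have "range f \<in> null_sets M" unfolding rng by (intro null_sets_UN) auto
  then show "emeasure M (range f) = 0" by auto
qed


section \<open>Dyadic squares and the Jones function\<close>

definition dyadic_floor :: "nat \<Rightarrow> real \<Rightarrow> real" where
  "dyadic_floor j x = of_int \<lfloor>x * 2 ^ j\<rfloor> * (1/2) ^ j"

text \<open>Levels are natural numbers because the Jones function runs only over squares of side at
  most 1.\<close>

definition dyadic_square_at :: "nat \<Rightarrow> real^2 \<Rightarrow> (real^2) set" where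
  "dyadic_square_at j x = half_open_square (\<chi> i. dyadic_floor j (x $ i)) ((1/2) ^ j)"

lemma dyadic_square_containing_eq:
  assumes "Q \<in> dyadic_squares" "side_length Q \<le> 1" "x \<in> Q"
  shows "\<exists>j. Q = dyadic_square_at j x"
proof -
  obtain j k l :: int where Q: "Q = half_open_square (vector [of_int k * 2 powi (-j), of_int l * 2 powi (-j)]) (2 powi (-j))"
    using assms by (auto simp: dyadic_squares_def)
  have "(2::real) powi (-j) > 0" by simp
  then have "2 powi (-j) \<le> (1::real)" using assms(2) Q by (simp del: zero_less_power_int)
  then have j: "j \<ge> 0"
    using one_less_power_int[of "2::real" "-j"] by (cases "j < 0") auto
  define n where "n = nat j"
  have pw: "2 powi (-j) = (1/2::real) ^ n"
    using j by (simp add: n_def power_int_def power_one_over inverse_eq_divide)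
  have fl: "\<lfloor>y * 2 ^ n\<rfloor> = m" if "of_int m * (1/2) ^ n \<le> y" "y < of_int m * (1/2) ^ n + (1/2) ^ n" for m :: int and y :: real
  proof -
    have "of_int m \<le> y * 2 ^ n" "y * 2 ^ n < of_int m + 1"
      using that by (simp_all add: field_simps)
    then show ?thesis by (simp add: floor_unique)
  qed
  have x: "of_int k * (1/2) ^ n \<le> x $ 1" "x $ 1 < of_int k * (1/2) ^ n + (1/2) ^ n"
      "of_int l * (1/2) ^ n \<le> x $ 2" "x $ 2 < of_int l * (1/2) ^ n + (1/2) ^ n"
    using assms(3) unfolding Q pw half_open_square_def by (auto simp: forall_2)
  have "Q = dyadic_square_at n x"
    unfolding Q pw dyadic_square_at_def dyadic_floor_def
    by (rule arg_cong[where f = "\<lambda>c. half_open_square c _"]) (simp add: vec_eq_iff forall_2 fl[OF x(1,2)] fl[OF x(3,4)])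
  then show ?thesis ..
qed

lemma side_length_dyadic_square_at [simp]: "side_length (dyadic_square_at j x) = (1/2) ^ j"
  by (simp add: dyadic_square_at_def)

text \<open>At most one square of each level contains a given point, so the unordered sum over
  squares is a series over levels, and every finite subsum is dominated by an initial segment of
  it.\<close>

lemma jones1_le:
  assumes "\<And>J. (\<Sum>j<J. ennreal ((beta2 M (triple (dyadic_square_at j x)))\<^sup>2) *
      (ennreal ((1/2) ^ j) / emeasure M (dyadic_square_at j x))) \<le> B"
  shows "jones1 M x \<le> B"
proof -
  define f where "f Q = ennreal ((beta2 M (triple Q))\<^sup>2) * (ennreal (side_length Q) / emeasure M Q) * indicator Q x" for Q
  have "sum f F \<le> B" if F: "finite F" "F \<subseteq> {Q \<in> dyadic_squares. side_length Q \<le> 1}" for F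
  proof -
    define G where "G = {Q \<in> F. x \<in> Q}"
    have "\<exists>j. Q = dyadic_square_at j x" if "Q \<in> G" for Q
      using that F dyadic_square_containing_eq by (auto simp: G_def)
    then obtain h where h: "\<And>Q. Q \<in> G \<Longrightarrow> Q = dyadic_square_at (h Q) x" by metis
    have fG: "finite G" using F by (simp add: G_def)
    obtain J where J: "\<And>Q. Q \<in> G \<Longrightarrow> h Q < J"
      using finite_nat_bounded[of "h ` G"] fG by auto
    have inj: "inj_on h G" using h by (metis inj_onI)
    have "sum f F = sum f G"
      using F by (intro sum.mono_neutral_right) (auto simp: G_def f_def indicator_def)
    also have "\<dots> \<le> (\<Sum>Q\<in>G. ennreal ((beta2 M (triple (dyadic_square_at (h Q) x)))\<^sup>2) *
      (ennreal ((1/2) ^ h Q) / emeasure M (dyadic_square_at (h Q) x)))"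
    proof (rule sum_mono)
      fix Q assume Q: "Q \<in> G"
      then have "indicator Q x = (1::ennreal)" by (auto simp: G_def)
      moreover have "side_length Q = (1/2) ^ h Q"
        using h[OF Q] side_length_dyadic_square_at by metis
      ultimately show "f Q \<le> ennreal ((beta2 M (triple (dyadic_square_at (h Q) x)))\<^sup>2) *
      (ennreal ((1/2) ^ h Q) / emeasure M (dyadic_square_at (h Q) x))"
        using h[OF Q] by (simp add: f_def)
    qed
    also have "\<dots> = (\<Sum>j\<in>h ` G. ennreal ((beta2 M (triple (dyadic_square_at j x)))\<^sup>2) *
      (ennreal ((1/2) ^ j) / emeasure M (dyadic_square_at j x)))"
      using inj by (simp add: sum.reindex)
    also have "\<dots> \<le> (\<Sum>j<J. ennreal ((beta2 M (triple (dyadic_square_at j x)))\<^sup>2) *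
      (ennreal ((1/2) ^ j) / emeasure M (dyadic_square_at j x)))"
      using J by (intro sum_mono2) auto
    also have "\<dots> \<le> B" by (rule assms)
    finally show ?thesis .
  qed
  then have "infsum f {Q \<in> dyadic_squares. side_length Q \<le> 1} \<le> B"
    by (subst nonneg_infsum_complete) (auto intro!: SUP_least)
  then show ?thesis unfolding jones1_def f_def .
qed

section \<open>Beta numbers tested against horizontal lines\<close>

lemma half_open_square_borel [measurable]: "half_open_square a s \<in> sets borel"
  unfolding half_open_square_def forall_2 by measurable

lemma bounded_half_open_square: "bounded (half_open_square a s)"
  by (rule bounded_subset[OF bounded_cbox[of a "\<chi> i. a $ i + s"]])
    (force simp: half_open_square_def mem_box_cart intro: less_imp_le)

lemma diameter_half_open_square_ge:
  assumes "l > 0"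
  shows "l \<le> diameter (half_open_square a (3 * l))"
proof -
  have "dist a (\<chi> i. a $ i + l) \<le> diameter (half_open_square a (3 * l))"
    using assms by (intro diameter_bounded_bound bounded_half_open_square) (auto simp: half_open_square_def)
  moreover have "l \<le> dist a (\<chi> i. a $ i + l)"
    using dist_vec_nth_le[of a 1 "(\<chi> i. a $ i + l) :: real^2"] assms by (simp add: dist_real_def)
  ultimately show ?thesis by simp
qed

lemma horizontal_line_in_affine_lines: "{y :: real^2. y $ 2 = h} \<in> affine_lines"
proof -
  have eq: "{y :: real^2. y $ 2 = h} = {y. axis 2 1 \<bullet> y = h}"
    by (simp add: cart_eq_inner_axis inner_commute)
  show ?thesis
    unfolding affine_lines_def eq
    by (simp add: affine_hyperplane)
qed

lemma infdist_horizontal_line_le: "infdist y {z :: real^2. z $ 2 = h} \<le> \<bar>y $ 2 - h\<bar>"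
proof -
  define z :: "real^2" where "z = (\<chi> i. if i = 2 then h else y $ i)"
  have "infdist y {z :: real^2. z $ 2 = h} \<le> dist y z"
    by (rule infdist_le) (simp add: z_def)
  also have "\<dots> = \<bar>y $ 2 - h\<bar>"
    by (simp add: dist_vec_def L2_set_def sum_2 z_def dist_real_def)
  finally show ?thesis .
qed

text \<open>The infimum is tested with the horizontal line at height \<open>h\<close>, the distance
  to which is at most the vertical displacement. In the construction all rows are horizontal, so
  only \<open>h\<close> has to be chosen later.\<close>

lemma beta2_sq_le:
  fixes M :: "(real^2) measure"
  assumes sb: "sets M = sets borel" and fin: "finite_measure M" and l: "l > 0"
    and Q: "Q = half_open_square a (3 * l)" and pos: "measure M Q > 0"
  shows "(beta2 M Q)\<^sup>2 \<le> (LINT y:Q|M. (y $ 2 - h)\<^sup>2) / (l\<^sup>2 * measure M Q)"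
proof -
  interpret finite_measure M by fact
  note [measurable_cong] = sb
  define L where "L = {y :: real^2. y $ 2 = h}"
  define g where "g y = (infdist y L / diameter Q)\<^sup>2" for y
  have Qm [measurable]: "Q \<in> sets M" using sb Q by simp
  have d: "l \<le> diameter Q" unfolding Q by (rule diameter_half_open_square_ge[OF l])
  have bd: "\<bar>y $ 2 - h\<bar> \<le> \<bar>a $ 2\<bar> + 3 * l + \<bar>h\<bar>" if "y \<in> Q" for y
    using that by (auto simp: Q half_open_square_def forall_2)
  have i1: "set_integrable M Q (\<lambda>y. (y $ 2 - h)\<^sup>2)"
    unfolding set_integrable_def
  proof (rule integrable_const_bound[where B = "(\<bar>a $ 2\<bar> + 3 * l + \<bar>h\<bar>)\<^sup>2"])
    show "AE y in M. norm (indicat_real Q y *\<^sub>R (y $ 2 - h)\<^sup>2) \<le> (\<bar>a $ 2\<bar> + 3 * l + \<bar>h\<bar>)\<^sup>2"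
      using bd l by (intro AE_I2) (auto simp: indicator_def power2_le_iff_abs_le)
  qed measurable
  have gle: "g y \<le> (y $ 2 - h)\<^sup>2 / l\<^sup>2" for y
  proof -
    have "infdist y L / diameter Q \<le> \<bar>y $ 2 - h\<bar> / l"
      using infdist_horizontal_line_le[of y h] d l by (intro frac_le) (auto simp: L_def infdist_nonneg)
    moreover have "0 \<le> infdist y L / diameter Q" using d l by (simp add: infdist_nonneg)
    ultimately have "g y \<le> (\<bar>y $ 2 - h\<bar> / l)\<^sup>2" unfolding g_def by (intro power_mono)
    then show ?thesis by (simp add: power_divide)
  qed
  have [measurable]: "(\<lambda>y. infdist y L) \<in> borel_measurable borel"
    by (intro borel_measurable_continuous_onI continuous_intros)
  have i2: "set_integrable M Q (\<lambda>y. (y $ 2 - h)\<^sup>2 / l\<^sup>2)"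
    using i1 by simp
  have i3: "set_integrable M Q g"
    by (rule set_integrable_bound[OF i2]) (use gle in \<open>auto simp: g_def set_borel_measurable_def\<close>)
  have nn: "0 \<le> (LINT y:Q|M. g y)"
    unfolding set_lebesgue_integral_def by (intro integral_nonneg_AE AE_I2) (auto simp: g_def)
  have "beta2 M Q \<le> sqrt (1 / measure M Q * (LINT y:Q|M. g y))"
    unfolding beta2_def g_def
    by (rule cINF_lower[OF _ horizontal_line_in_affine_lines[of h, folded L_def]])
      (auto intro!: bdd_belowI[where m = 0] integral_nonneg_AE simp: set_lebesgue_integral_def)
  \<comment> \<open>Squaring the comparison requires a nonnegative infimum, which rests on the
    existence of a line.\<close>
  moreover have "0 \<le> beta2 M Q"
    unfolding beta2_def
    by (rule cINF_greatest) (use horizontal_line_in_affine_lines in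
      \<open>auto intro!: integral_nonneg_AE simp: set_lebesgue_integral_def\<close>)
  ultimately have "(beta2 M Q)\<^sup>2 \<le> (sqrt (1 / measure M Q * (LINT y:Q|M. g y)))\<^sup>2"
    by (intro power_mono)
  also have "\<dots> = 1 / measure M Q * (LINT y:Q|M. g y)" using nn by simp
  also have "\<dots> \<le> 1 / measure M Q * (LINT y:Q|M. (y $ 2 - h)\<^sup>2 / l\<^sup>2)"
    by (intro mult_left_mono set_integral_mono i3 i2 gle) simp
  also have "(LINT y:Q|M. (y $ 2 - h)\<^sup>2 / l\<^sup>2) = (LINT y:Q|M. (y $ 2 - h)\<^sup>2) / l\<^sup>2"
    by simp
  finally show ?thesis by (simp add: mult.commute)
qed

text \<open>A mean squared deviation of at most \<open>c\<close> on the triple bounds the squared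
  beta number by \<open>c / l\<^sup>2\<close>, with \<open>l\<close> the side, and the weight is at
  most \<open>l / m\<close>. Every term of the Jones function is estimated in this way.\<close>

lemma jones1_term_le:
  fixes M :: "(real^2) measure"
  assumes sb: "sets M = sets borel" and fin: "finite_measure M"
    and int: "(LINT y:triple (dyadic_square_at j x)|M. (y $ 2 - h)\<^sup>2) \<le> c * measure M (triple (dyadic_square_at j x))"
    and Q: "measure M (dyadic_square_at j x) \<ge> m" and m: "m > 0"
  shows "ennreal ((beta2 M (triple (dyadic_square_at j x)))\<^sup>2) *
      (ennreal ((1/2) ^ j) / emeasure M (dyadic_square_at j x)) \<le> ennreal (c / ((1/2) ^ j * m))"
proof -
  interpret finite_measure M by fact
  define l :: real where "l = (1/2) ^ j"
  have l: "l > 0" by (simp add: l_def)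
  define Q where "Q = dyadic_square_at j x"
  obtain a where Qa: "Q = half_open_square a l" by (simp add: Q_def dyadic_square_at_def l_def)
  have tQ: "triple Q = half_open_square (\<chi> i. a $ i - l) (3 * l)"
    unfolding Qa by (rule triple_half_open_square[OF l])
  have sub: "Q \<subseteq> triple Q" 
  proof
    fix y assume "y \<in> Q"
    then have "a $ i \<le> y $ i \<and> y $ i < a $ i + l" for i by (simp add: Qa half_open_square_def)
    then have "a $ i - l \<le> y $ i \<and> y $ i < a $ i - l + 3 * l" for i using l by (smt (verit))
    then show "y \<in> triple Q" by (simp add: tQ half_open_square_def)
  qed
  have "measure M Q \<le> measure M (triple Q)"
    using sub sb by (intro finite_measure_mono) (auto simp: tQ)
  with Q m have pos: "measure M Q > 0" "measure M (triple Q) > 0" by (auto simp: Q_def)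
  have "(beta2 M (triple Q))\<^sup>2 \<le> (LINT y:triple Q|M. (y $ 2 - h)\<^sup>2) / (l\<^sup>2 * measure M (triple Q))"
    by (rule beta2_sq_le[OF sb fin l tQ pos(2)])
  also have "\<dots> \<le> c * measure M (triple Q) / (l\<^sup>2 * measure M (triple Q))"
    using int by (intro divide_right_mono) (auto simp: Q_def)
  also have "\<dots> = c / l\<^sup>2" using pos by simp
  finally have b: "(beta2 M (triple Q))\<^sup>2 \<le> c / l\<^sup>2" .
  then have "0 \<le> c / l\<^sup>2" by (meson order_trans zero_le_power2)
  then have c: "c \<ge> 0" using l by (simp add: zero_le_divide_iff)
  have "ennreal ((beta2 M (triple Q))\<^sup>2) * (ennreal l / emeasure M Q)
      = ennreal ((beta2 M (triple Q))\<^sup>2 * (l / measure M Q))"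
    using pos l by (simp add: emeasure_eq_measure divide_ennreal flip: ennreal_mult)
  also have "\<dots> \<le> ennreal (c / l\<^sup>2 * (l / m))"
    using b c l Q m pos by (intro ennreal_leI mult_mono divide_left_mono) (auto simp: Q_def)
  also have "c / l\<^sup>2 * (l / m) = c / (l * m)"
    using l m by (simp add: power2_eq_square)
  finally show ?thesis by (simp add: Q_def l_def)
qed


section \<open>Grid points: integer multiples of a power of one half\<close>

definition dyadic :: "nat \<Rightarrow> real \<Rightarrow> bool" where
  "dyadic j x \<longleftrightarrow> (\<exists>z::int. x = of_int z * (1/2) ^ j)"

lemma dyadic_add: "dyadic j x \<Longrightarrow> dyadic j y \<Longrightarrow> dyadic j (x + y)"
  by (auto simp: dyadic_def ring_distribs[symmetric] simp flip: of_int_add)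

lemma dyadic_diff: "dyadic j x \<Longrightarrow> dyadic j y \<Longrightarrow> dyadic j (x - y)"
  by (auto simp: dyadic_def left_diff_distrib[symmetric] simp flip: of_int_diff)

lemma dyadic_0 [simp]: "dyadic j 0"
  unfolding dyadic_def by (rule exI[of _ 0]) simp

lemma dyadic_mult_nat: "dyadic j x \<Longrightarrow> dyadic j (x * real p)"
proof -
  assume "dyadic j x"
  then obtain z :: int where "x = of_int z * (1/2) ^ j" by (auto simp: dyadic_def)
  then have "x * real p = of_int (z * int p) * (1/2) ^ j" by simp
  then show ?thesis unfolding dyadic_def by blast
qed

lemma dyadic_mono: "dyadic i x \<Longrightarrow> i \<le> j \<Longrightarrow> dyadic j x"
proof -
  assume "dyadic i x" and ij: "i \<le> j"
  then obtain z :: int where z: "x = of_int z * (1/2) ^ i" by (auto simp: dyadic_def)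
  have "(1/2::real) ^ i = 2 ^ (j - i) * (1/2) ^ j"
    using ij by (simp add: power_one_over power_diff)
  then have "x = of_int (z * 2 ^ (j - i)) * (1/2) ^ j" using z by simp
  then show ?thesis unfolding dyadic_def by blast
qed

lemma dyadic_power: "i \<le> j \<Longrightarrow> dyadic j ((1/2) ^ i)"
  by (rule dyadic_mono[of i]) (auto simp: dyadic_def intro: exI[of _ 1])

text \<open>Distinct multiples of a step differ by at least one step. Strict inequalities between
  grid coordinates thus become full separation, so that grid-aligned squares never overlap
  partially.\<close>

lemma dyadic_less_imp_add_le:
  assumes "dyadic j x" "dyadic j y" "x < y"
  shows "x + (1/2) ^ j \<le> y"
proof -
  obtain z w :: int where *: "x = of_int z * (1/2) ^ j" "y = of_int w * (1/2) ^ j"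
    using assms by (auto simp: dyadic_def)
  then have "z < w" using assms(3) by simp
  then have "real_of_int z + 1 \<le> of_int w" by linarith
  then have "(real_of_int z + 1) * (1/2) ^ j \<le> of_int w * (1/2) ^ j" by (intro mult_right_mono) auto
  then show ?thesis using * by (simp add: distrib_right)
qed

lemma dyadic_dyadic_floor: "dyadic j (dyadic_floor j x)"
  by (auto simp: dyadic_def dyadic_floor_def)

lemma dyadic_floor_le: "dyadic_floor j x \<le> x"
  and dyadic_floor_gt: "x < dyadic_floor j x + (1/2) ^ j"
proof -
  have a: "of_int \<lfloor>x * 2 ^ j\<rfloor> \<le> x * 2 ^ j" "x * 2 ^ j < of_int \<lfloor>x * 2 ^ j\<rfloor> + 1" by linarith+
  show "dyadic_floor j x \<le> x" "x < dyadic_floor j x + (1/2) ^ j"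
    using a by (simp_all add: dyadic_floor_def field_simps)
qed

lemma dyadic_floor_eqI:
  assumes "dyadic j u" "u \<le> x" "x < u + (1/2) ^ j"
  shows "dyadic_floor j x = u"
  using dyadic_less_imp_add_le[of j u "dyadic_floor j x"] dyadic_less_imp_add_le[of j "dyadic_floor j x" u]
    dyadic_dyadic_floor[of j x] dyadic_floor_le[of j x] dyadic_floor_gt[of x j] assms by linarith

lemma dyadic_le_floor: "dyadic j u \<Longrightarrow> u \<le> x \<Longrightarrow> u \<le> dyadic_floor j x"
  using dyadic_less_imp_add_le[of j "dyadic_floor j x" u] dyadic_dyadic_floor[of j x] dyadic_floor_gt[of x j]
  by linarith

lemma mem_dyadic_square_at:
  "y \<in> dyadic_square_at j x \<longleftrightarrow>
     (\<forall>k. dyadic_floor j (x $ k) \<le> y $ k \<and> y $ k < dyadic_floor j (x $ k) + (1/2) ^ j)"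
  by (simp add: dyadic_square_at_def half_open_square_def)

lemma triple_dyadic_square_at:
  "triple (dyadic_square_at j x) = half_open_square (\<chi> k. dyadic_floor j (x $ k) - (1/2) ^ j) (3 * (1/2) ^ j)"
  by (simp add: dyadic_square_at_def triple_half_open_square)

lemma mem_triple_dyadic_square_at:
  "y \<in> triple (dyadic_square_at j x) \<longleftrightarrow>
     (\<forall>k. dyadic_floor j (x $ k) - (1/2) ^ j \<le> y $ k \<and> y $ k < dyadic_floor j (x $ k) + 2 * (1/2) ^ j)"
  unfolding triple_dyadic_square_at half_open_square_def by (auto simp: algebra_simps)

lemma dyadic_square_at_borel [measurable]: "dyadic_square_at j x \<in> sets borel"
  by (simp add: dyadic_square_at_def)

lemma triple_dyadic_square_at_borel [measurable]: "triple (dyadic_square_at j x) \<in> sets borel"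
  by (simp add: triple_dyadic_square_at)

text \<open>Since \<open>lo\<close> is itself a multiple of \<open>g\<close>, there is no rounding
  error: the half-open interval of length \<open>g * q\<close> contains exactly \<open>q\<close>
  integer multiples of \<open>g\<close>. Only those with a natural factor are counted, whence
  \<open>z \<ge> 0\<close> for equality.\<close>

lemma card_multiples_in_interval:
  fixes g lo :: real and z :: int and q :: nat
  assumes "g > 0" "lo = g * of_int z"
  shows "finite {p::nat. lo \<le> g * real p \<and> g * real p < lo + g * real q}"
    and "card {p::nat. lo \<le> g * real p \<and> g * real p < lo + g * real q} \<le> q"
    and "z \<ge> 0 \<Longrightarrow> card {p::nat. lo \<le> g * real p \<and> g * real p < lo + g * real q} = q"
proof -
  have iff: "lo \<le> g * real p \<and> g * real p < lo + g * real q \<longleftrightarrow> z \<le> int p \<and> int p < z + int q" for p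
  proof -
    have "lo + g * real q = g * of_int (z + int q)" using assms by (simp add: distrib_left)
    moreover have "g * real p = g * of_int (int p)" by simp
    ultimately show ?thesis using assms by (simp only: mult_le_cancel_left_pos mult_less_cancel_left_pos of_int_le_iff of_int_less_iff)
  qed
  define A where "A = {p::nat. z \<le> int p \<and> int p < z + int q}"
  have eq: "{p::nat. lo \<le> g * real p \<and> g * real p < lo + g * real q} = A"
    using iff by (simp add: A_def)
  have sub: "int ` A \<subseteq> {z..<z + int q}" by (auto simp: A_def)
  have fin: "finite A" using finite_subset[OF sub] by (auto dest: finite_imageD)
  have "card A = card (int ` A)" by (simp add: card_image)
  also have "\<dots> \<le> card {z..<z + int q}" using sub by (intro card_mono) auto
  finally have le: "card A \<le> q" by simp
  show "finite {p::nat. lo \<le> g * real p \<and> g * real p < lo + g * real q}"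
    "card {p::nat. lo \<le> g * real p \<and> g * real p < lo + g * real q} \<le> q"
    unfolding eq by fact+
  assume "z \<ge> 0"
  then have "A = {nat z..<nat z + q}" by (auto simp: A_def)
  then show "card {p::nat. lo \<le> g * real p \<and> g * real p < lo + g * real q} = q"
    unfolding eq by simp
qed

lemma sum_powers_le_2: "(\<Sum>j\<in>{a<..b}. (1/2::real) ^ (b - j)) \<le> 2"
proof (cases "a \<le> b")
  case True
  have "(\<Sum>j\<in>{a<..b}. (1/2::real) ^ (b - j)) = (\<Sum>i<b - a. (1/2) ^ i)"
    using True by (intro sum.reindex_bij_witness[where i = "\<lambda>i. b - i" and j = "\<lambda>j. b - j"]) auto
  also have "\<dots> = 2 * (1 - (1/2) ^ (b - a))" by (subst geometric_sum) auto
  also have "\<dots> \<le> 2" by simp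
  finally show ?thesis .
qed simp

text \<open>Tychonoff's theorem, in the form applied to sets of digit sequences.\<close>

lemma compact_PiE_finite:
  fixes D :: "'i \<Rightarrow> 'a::topological_space set"
  assumes "\<And>n. finite (D n)"
  shows "compact (PiE UNIV D)"
  using compactin_PiE[of "\<lambda>_. euclidean" UNIV D] assms
  by (simp add: euclidean_product_topology finite_imp_compact)

section \<open>The Cantor set\<close>

text \<open>
  \<open>side n\<close> is the side of the squares of the \<open>n\<close>-th generation, whose parameter is \<open>b = b0 + n\<close>.
  Row \<open>0\<close> is the centre row, rows \<open>1, \<dots>, 4\<^sup>b\<close> are the satellites; \<open>gap n i\<close> is the horizontal
  spacing of the squares of the next generation in row \<open>i\<close>. The choice of \<open>step_exp\<close> makes the gap
  of a satellite equal to half of the lowest satellite height.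
\<close>

locale satellite_cantor =
  fixes b0 :: nat
begin

definition step_exp :: "nat \<Rightarrow> nat" where
  "step_exp n = 2 * 4 ^ (b0 + n) + 2 * (b0 + n) + 3"

text \<open>The initial value normalises the total mass: it makes \<open>mass 0 = 1\<close>.\<close>

primrec side_exp :: "nat \<Rightarrow> nat" where
  "side_exp 0 = b0 + 1"
| "side_exp (Suc n) = side_exp n + step_exp n"

definition side :: "nat \<Rightarrow> real" where
  "side n = (1/2) ^ side_exp n"

definition rows :: "nat \<Rightarrow> nat" where
  "rows n = 4 ^ (b0 + n)"

definition height :: "nat \<Rightarrow> nat \<Rightarrow> real" where
  "height n i = (if i = 0 then 0 else side n * (1/4) ^ i)"

text \<open>Write \<open>b = b0 + n\<close>. As a square of the next generation has mass
  \<open>2 ^ (b + 2) * side (Suc n)\<close>, these exponents produce the linear densities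
  \<open>2 ^ b\<close> and \<open>(1/2) ^ b\<close>.\<close>

definition gap_exp :: "nat \<Rightarrow> nat \<Rightarrow> nat" where
  "gap_exp n i = (if i = 0 then 2 else 2 * (b0 + n) + 2)"

definition gap :: "nat \<Rightarrow> nat \<Rightarrow> real" where
  "gap n i = 2 ^ gap_exp n i * side (Suc n)"

definition row_card :: "nat \<Rightarrow> nat \<Rightarrow> nat" where
  "row_card n i = 2 ^ (step_exp n - gap_exp n i)"

text \<open>The lower left corner of a child, relative to the lower left corner of its
  parent.\<close>

definition digit :: "nat \<Rightarrow> nat \<Rightarrow> nat \<Rightarrow> real^2" where
  "digit n i p = vector [gap n i * real p, height n i]"

definition digits :: "nat \<Rightarrow> (real^2) set" where
  "digits n = (\<lambda>(i, p). digit n i p) ` (SIGMA i:{..rows n}. {..<row_card n i})"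

section \<open>Position, separation and grid alignment of the children of a square\<close>

lemma side_pos [simp]: "side n > 0"
  by (simp add: side_def)

lemma side_Suc: "side (Suc n) = side n * (1/2) ^ step_exp n"
  by (simp add: side_def power_add)

lemma gap_exp_less: "gap_exp n i < step_exp n"
  by (simp add: gap_exp_def step_exp_def)

lemma step_exp_ge_3: "step_exp n \<ge> 3"
  by (simp add: step_exp_def)

lemma side_Suc_le: "8 * side (Suc n) \<le> side n"
proof -
  have "(1/2::real) ^ step_exp n \<le> (1/2) ^ 3"
    by (intro power_decreasing step_exp_ge_3) auto
  then have "side n * (1/2) ^ step_exp n \<le> side n * (1/2) ^ 3" by (intro mult_left_mono) (auto simp: less_imp_le)
  then show ?thesis unfolding side_Suc by (simp add: power3_eq_cube)
qed

lemma gap_pos [simp]: "gap n i > 0"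
  by (simp add: gap_def)

lemma gap_ge: "4 * side (Suc n) \<le> gap n i"
proof -
  have "(2::real) ^ 2 \<le> 2 ^ gap_exp n i" by (intro power_increasing) (auto simp: gap_exp_def)
  then show ?thesis unfolding gap_def by (intro mult_right_mono) (auto simp: less_imp_le)
qed

lemma gap_row_card: "gap n i * real (row_card n i) = side n"
proof -
  have "(2::real) ^ gap_exp n i * 2 ^ (step_exp n - gap_exp n i) = 2 ^ step_exp n"
    using gap_exp_less[of n i] by (simp flip: power_add)
  then show ?thesis
    by (simp add: gap_def row_card_def side_Suc power_one_over field_simps)
qed

lemma gap_eq_power: "gap n i = (1/2) ^ (side_exp (Suc n) - gap_exp n i)"
proof -
  have "gap_exp n i \<le> side_exp (Suc n)" using gap_exp_less[of n i] by simp
  then show ?thesis by (simp add: gap_def side_def power_one_over power_diff del: side_exp.simps)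
qed

lemma height_eq_power: "i > 0 \<Longrightarrow> height n i = (1/2) ^ (side_exp n + 2 * i)"
  by (simp add: height_def side_def power_add power_mult power2_eq_square)

lemma height_0 [simp]: "height n 0 = 0"
  by (simp add: height_def)

lemma height_pos: "i > 0 \<Longrightarrow> height n i > 0"
  by (simp add: height_def)

lemma height_nonneg: "0 \<le> height n i"
  by (simp add: height_def less_imp_le)

lemma height_le: "height n i \<le> side n / 4"
proof (cases "i = 0")
  case False
  then have "(1/4::real) ^ i \<le> (1/4) ^ 1" by (intro power_decreasing) auto
  then have "side n * (1/4::real) ^ i \<le> side n * (1/4) ^ 1" by (intro mult_left_mono) (auto simp: less_imp_le)
  then show ?thesis using False by (simp add: height_def)
qed (simp add: less_imp_le)

text \<open>Here the form of \<open>step_exp\<close> enters: \<open>2 * 4 ^ (b0 + n)\<close>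
  halvings lead from \<open>side n\<close> to the lowest satellite height, and the remaining
  \<open>2 * (b0 + n) + 3\<close> are one more than the exponent of the satellite gap.\<close>

lemma height_last: "height n (rows n) = 2 * (2 ^ (2 * (b0 + n) + 2) * side (Suc n))"
proof -
  have "rows n > 0" by (simp add: rows_def)
  then have "height n (rows n) = side n * (1/2) ^ (2 * 4 ^ (b0 + n))"
    by (simp add: height_def rows_def power_mult power2_eq_square)
  also have "\<dots> = 2 * (2 ^ (2 * (b0 + n) + 2) * side (Suc n))"
    unfolding side_Suc step_exp_def by (simp add: power_add power_one_over)
  finally show ?thesis .
qed

lemma height_antimono: "0 < i \<Longrightarrow> i \<le> k \<Longrightarrow> height n k \<le> height n i"
  by (auto simp: height_def intro!: mult_left_mono power_decreasing less_imp_le)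

lemma height_less: "0 < i \<Longrightarrow> i < k \<Longrightarrow> 4 * height n k \<le> height n i"
  using height_antimono[of i "k - 1" n]
  by (cases k) (auto simp: height_def split: if_splits)

lemma gap_le_height: "0 < i \<Longrightarrow> i \<le> rows n \<Longrightarrow> 2 * gap n i \<le> height n i"
  using height_antimono[of i "rows n" n] by (simp add: height_last gap_def gap_exp_def)

text \<open>Consecutive satellite heights differ by a factor 4, and each is at least two gaps, that
  is, eight child sides.\<close>

lemma height_separated:
  assumes "i \<noteq> k" "i \<le> rows n" "k \<le> rows n"
  shows "4 * side (Suc n) \<le> \<bar>height n i - height n k\<bar>"
proof -
  have *: "4 * side (Suc n) \<le> \<bar>height n i - height n k\<bar>" if "i < k" "k \<le> rows n" for i k
  proof (cases "i = 0")
    case True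
    then show ?thesis
      using gap_le_height[of k n] gap_ge[of n k] that height_pos[of k n] side_pos[of "Suc n"] by simp
  next
    case False
    then show ?thesis
      using height_less[of i k n] gap_le_height[of i n] gap_ge[of n i] that side_pos[of "Suc n"] height_pos[of k n]
      by simp
  qed
  show ?thesis using *[of i k] *[of k i] assms by (cases "i < k") (auto simp: abs_minus_commute)
qed

lemma digit_nth [simp]: "digit n i p $ 1 = gap n i * real p" "digit n i p $ 2 = height n i"
  by (simp_all add: digit_def)

lemma digits_cases:
  assumes "v \<in> digits n"
  obtains i p where "i \<le> rows n" "p < row_card n i" "v = digit n i p"
  using assms by (auto simp: digits_def)

lemma digit_in_digits: "i \<le> rows n \<Longrightarrow> p < row_card n i \<Longrightarrow> digit n i p \<in> digits n"
  by (force simp: digits_def)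

lemma height_inj: "height n i = height n k \<Longrightarrow> i \<le> rows n \<Longrightarrow> k \<le> rows n \<Longrightarrow> i = k"
  using height_separated[of i k n] side_pos[of "Suc n"] by (cases "i = k") auto

lemma digit_inj:
  assumes "digit n i p = digit n k q" "i \<le> rows n" "k \<le> rows n"
  shows "i = k \<and> p = q"
proof -
  have "digit n i p $ 2 = digit n k q $ 2" "digit n i p $ 1 = digit n k q $ 1" using assms by simp_all
  then have "height n i = height n k" "gap n i * real p = gap n k * real q" by simp_all
  moreover from this have "i = k" using height_inj assms by blast
  ultimately show ?thesis using gap_pos[of n k] by simp
qed

lemma finite_digits [simp]: "finite (digits n)"
  by (simp add: digits_def)

lemma digits_nonempty [simp]: "digits n \<noteq> {}"
  using digit_in_digits[of 0 n 0] by (auto simp: row_card_def)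

text \<open>The centre row contributes \<open>2 ^ (step_exp n - 2)\<close> digits, and the
  \<open>4 ^ (b0 + n)\<close> satellite rows together contribute as many again.\<close>

lemma card_digits: "card (digits n) = 2 ^ (step_exp n - 1)"
proof -
  have "inj_on (\<lambda>(i, p). digit n i p) (SIGMA i:{..rows n}. {..<row_card n i})"
    by (auto simp: inj_on_def dest: digit_inj)
  then have "card (digits n) = (\<Sum>i\<le>rows n. row_card n i)"
    by (simp add: digits_def card_image)
  also have "\<dots> = row_card n 0 + (\<Sum>i\<in>{1..rows n}. row_card n i)"
    by (simp add: sum.atLeast1_atMost_eq sum.atMost_shift lessThan_Suc_atMost)
  also have "(\<Sum>i\<in>{1..rows n}. row_card n i) = (\<Sum>i\<in>{1..rows n}. 2 ^ (step_exp n - (2 * (b0 + n) + 2)))"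
    by (intro sum.cong) (auto simp: row_card_def gap_exp_def)
  also have "\<dots> = 4 ^ (b0 + n) * 2 ^ (step_exp n - (2 * (b0 + n) + 2))" by (simp add: rows_def)
  also have "\<dots> = 2 ^ (2 * (b0 + n) + (step_exp n - (2 * (b0 + n) + 2)))"
    by (simp add: power_add power_mult)
  also have "2 * (b0 + n) + (step_exp n - (2 * (b0 + n) + 2)) = step_exp n - 2"
    by (simp add: step_exp_def)
  also have "row_card n 0 = 2 ^ (step_exp n - 2)" by (simp add: row_card_def gap_exp_def)
  also have "2 ^ (step_exp n - 2) + 2 ^ (step_exp n - 2) = (2::nat) ^ Suc (step_exp n - 2)" by simp
  also have "Suc (step_exp n - 2) = step_exp n - 1" using step_exp_ge_3[of n] by simp
  finally show ?thesis .
qed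

text \<open>A child would fit with one side length of room. The three spare ones provide the strict
  inequality in \<open>point_bounds\<close>.\<close>

lemma digit_bounds:
  assumes "v \<in> digits n"
  shows "0 \<le> v $ k" "v $ k + 4 * side (Suc n) \<le> side n"
proof -
  obtain i p where ip: "i \<le> rows n" "p < row_card n i" "v = digit n i p"
    using assms by (rule digits_cases)
  have 1: "0 \<le> v $ 1" "v $ 1 + 4 * side (Suc n) \<le> side n"
  proof -
    have "gap n i * (real p + 1) \<le> gap n i * real (row_card n i)"
      using ip by (intro mult_left_mono) (auto simp: less_imp_le)
    then show "v $ 1 + 4 * side (Suc n) \<le> side n"
      using gap_ge[of n i] by (simp add: ip gap_row_card distrib_left)
  qed (simp add: ip less_imp_le)
  have 2: "0 \<le> v $ 2" "v $ 2 + 4 * side (Suc n) \<le> side n"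
    using height_le[of n i] side_Suc_le[of n] side_pos[of n] height_nonneg[of n i]
    unfolding ip digit_nth by linarith+
  show "0 \<le> v $ k" "v $ k + 4 * side (Suc n) \<le> side n"
    using 1 2 exhaust_2[of k] by auto
qed

lemma digits_separated:
  assumes "v \<in> digits n" "w \<in> digits n" "v \<noteq> w"
  shows "\<exists>k. 4 * side (Suc n) \<le> \<bar>v $ k - w $ k\<bar>"
proof -
  obtain i p where ip: "i \<le> rows n" "p < row_card n i" "v = digit n i p"
    using assms(1) by (rule digits_cases)
  obtain k q where kq: "k \<le> rows n" "q < row_card n k" "w = digit n k q"
    using assms(2) by (rule digits_cases)
  show ?thesis
  proof (cases "i = k")
    case True
    then have "p \<noteq> q" using assms ip kq by auto
    then have "1 \<le> \<bar>real p - real q\<bar>" by linarith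
    then have "gap n i * 1 \<le> gap n i * \<bar>real p - real q\<bar>" by (intro mult_left_mono) (auto simp: less_imp_le)
    also have "\<dots> = \<bar>v $ 1 - w $ 1\<bar>" using True ip kq by (simp add: abs_mult less_imp_le flip: right_diff_distrib)
    finally show ?thesis using gap_ge[of n i] by (intro exI[of _ 1]) simp
  next
    case False
    then have "4 * side (Suc n) \<le> \<bar>v $ 2 - w $ 2\<bar>"
      using height_separated[of i k n] ip kq by simp
    then show ?thesis ..
  qed
qed

lemma dyadic_height: "i \<le> rows n \<Longrightarrow> dyadic (side_exp (Suc n)) (height n i)"
  by (cases "i = 0") (auto simp: height_eq_power rows_def step_exp_def intro!: dyadic_power)

lemma dyadic_digit:
  assumes "v \<in> digits n"
  shows "dyadic (side_exp (Suc n)) (v $ k)"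
proof -
  obtain i p where ip: "i \<le> rows n" "p < row_card n i" "v = digit n i p"
    using assms by (rule digits_cases)
  have "dyadic (side_exp (Suc n)) (v $ 1)"
    by (simp add: ip gap_eq_power dyadic_mult_nat dyadic_power del: side_exp.simps)
  moreover have "dyadic (side_exp (Suc n)) (v $ 2)"
    using dyadic_height[of i n] ip by (simp del: side_exp.simps)
  ultimately show ?thesis using exhaust_2[of k] by auto
qed

section \<open>Coding of the Cantor set by digit sequences\<close>

definition codes :: "(nat \<Rightarrow> real^2) set" where
  "codes = PiE UNIV digits"

definition corner :: "nat \<Rightarrow> (nat \<Rightarrow> real^2) \<Rightarrow> real^2" where
  "corner n \<omega> = (\<Sum>i<n. \<omega> i)"

definition point :: "(nat \<Rightarrow> real^2) \<Rightarrow> real^2" where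
  "point \<omega> = (\<Sum>i. \<omega> i)"

lemma codesD: "\<omega> \<in> codes \<Longrightarrow> \<omega> n \<in> digits n"
  by (auto simp: codes_def)

lemma corner_Suc: "corner (Suc n) \<omega> = corner n \<omega> + \<omega> n"
  by (simp add: corner_def)

lemma corner_cong: "(\<And>i. i < n \<Longrightarrow> \<omega> i = \<omega>' i) \<Longrightarrow> corner n \<omega> = corner n \<omega>'"
  by (simp add: corner_def)

lemma le_side_exp: "n \<le> side_exp n"
proof (induction n)
  case (Suc n) then show ?case using step_exp_ge_3[of n] by simp
qed simp

lemma side_le_power: "side n \<le> (1/2) ^ n"
proof -
  show ?thesis unfolding side_def by (intro power_decreasing le_side_exp) auto
qed

lemma norm_digit_le: "v \<in> digits n \<Longrightarrow> norm v \<le> 2 * (1/2) ^ n"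
proof -
  assume v: "v \<in> digits n"
  have "norm v \<le> (\<Sum>i\<in>UNIV. \<bar>v $ i\<bar>)" by (rule norm_le_l1_cart)
  also have "\<dots> \<le> (\<Sum>i\<in>(UNIV::2 set). side n)"
    using digit_bounds[OF v] side_pos[of "Suc n"] by (intro sum_mono) (smt (verit))
  also have "\<dots> \<le> 2 * (1/2) ^ n" using side_le_power[of n] by simp
  finally show ?thesis .
qed

lemma corner_tendsto_point:
  assumes "\<omega> \<in> codes"
  shows "(\<lambda>n. corner n \<omega>) \<longlonglongrightarrow> point \<omega>"
proof -
  have "summable \<omega>"
    by (rule summable_comparison_test'[where g = "\<lambda>n. 2 * (1/2) ^ n" and N = 0])
      (auto intro!: norm_digit_le codesD assms)
  then show ?thesis unfolding corner_def point_def by (rule summable_LIMSEQ)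
qed

lemma corner_nested:
  assumes "\<omega> \<in> codes" "n \<le> m"
  shows "corner n \<omega> $ k \<le> corner m \<omega> $ k" "corner m \<omega> $ k + side m \<le> corner n \<omega> $ k + side n"
  using assms(2)
proof (induction m rule: dec_induct)
  case (step m)
  note b = digit_bounds[OF codesD[OF assms(1), of m], of k]
  {
    case 1 then show ?case using step b by (simp add: corner_Suc)
  next
    case 2 then show ?case
      using step b side_pos[of "Suc m"] unfolding corner_Suc vector_add_component by linarith
  }
qed auto

text \<open>The limit of nested squares alone gives a weak upper inequality. Strictness comes from
  the next generation, whose squares keep away from the right and upper edges of the parent.\<close>

lemma point_bounds:
  assumes "\<omega> \<in> codes"
  shows "corner n \<omega> $ k \<le> point \<omega> $ k" "point \<omega> $ k < corner n \<omega> $ k + side n"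
proof -
  have lim: "(\<lambda>n. corner n \<omega> $ k) \<longlonglongrightarrow> point \<omega> $ k"
    by (intro tendsto_vec_nth corner_tendsto_point assms)
  show "corner n \<omega> $ k \<le> point \<omega> $ k"
    by (rule LIMSEQ_le_const[OF lim]) (use corner_nested[OF assms] in blast)
  have "point \<omega> $ k \<le> corner (Suc n) \<omega> $ k + side (Suc n)"
  proof (rule LIMSEQ_le_const2[OF lim], intro exI allI impI)
    fix m assume "Suc n \<le> m"
    from corner_nested(2)[OF assms this, of k] show "corner m \<omega> $ k \<le> corner (Suc n) \<omega> $ k + side (Suc n)"
      using side_pos[of m] by linarith
  qed
  also have "\<dots> < corner n \<omega> $ k + side n"
    using digit_bounds(2)[OF codesD[OF assms, of n], of k] side_pos[of "Suc n"]
    unfolding corner_Suc vector_add_component by linarith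
  finally show "point \<omega> $ k < corner n \<omega> $ k + side n" .
qed

lemma side_antimono: "n \<le> m \<Longrightarrow> side m \<le> side n"
proof (induction m rule: dec_induct)
  case (step m) then show ?case using side_Suc_le[of m] side_pos[of "Suc m"] by linarith
qed auto

text \<open>At the first index \<open>m\<close> where the codes differ, the corners of generation
  \<open>Suc m\<close> are four sides apart in some coordinate, while each point is within one side
  of its corner.\<close>

lemma points_separated:
  assumes "\<omega> \<in> codes" "\<omega>' \<in> codes" "i < n" "\<omega> i \<noteq> \<omega>' i"
  shows "\<exists>k. side n \<le> \<bar>point \<omega> $ k - point \<omega>' $ k\<bar>"
proof -
  define m where "m = (LEAST i. \<omega> i \<noteq> \<omega>' i)"
  have m: "\<omega> m \<noteq> \<omega>' m" "m < n" "\<And>i. i < m \<Longrightarrow> \<omega> i = \<omega>' i"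
    using LeastI[of "\<lambda>i. \<omega> i \<noteq> \<omega>' i" i] Least_le[of "\<lambda>i. \<omega> i \<noteq> \<omega>' i" i] not_less_Least assms
    by (force simp: m_def)+
  obtain k where k: "4 * side (Suc m) \<le> \<bar>\<omega> m $ k - \<omega>' m $ k\<bar>"
    using digits_separated[OF codesD[OF assms(1)] codesD[OF assms(2)] m(1)] by blast
  have "corner m \<omega> = corner m \<omega>'" using m by (intro corner_cong) auto
  then have "side (Suc m) \<le> \<bar>point \<omega> $ k - point \<omega>' $ k\<bar>"
    using k point_bounds[OF assms(1), where n = "Suc m" and k = k]
      point_bounds[OF assms(2), where n = "Suc m" and k = k]
    by (simp add: corner_Suc)
  moreover have "side n \<le> side (Suc m)" using m by (intro side_antimono) simp
  ultimately show ?thesis by (intro exI[of _ k]) linarith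
qed

text \<open>Digits of earlier generations are multiples of coarser steps. Hence the squares of the
  construction are aligned with the dyadic grid of their own side.\<close>

lemma dyadic_corner: "\<omega> \<in> codes \<Longrightarrow> dyadic (side_exp n) (corner n \<omega> $ k)"
proof (induction n)
  case (Suc n)
  have "dyadic (side_exp (Suc n)) (corner n \<omega> $ k)"
    by (rule dyadic_mono[OF Suc.IH[OF Suc.prems]]) simp
  then show ?case
    using dyadic_digit[OF codesD[OF Suc.prems]] by (simp add: corner_Suc dyadic_add del: side_exp.simps)
qed (simp add: corner_def)

lemma continuous_on_point: "continuous_on codes point"
proof -
  have "uniform_limit codes (\<lambda>n \<omega>. \<Sum>i<n. \<omega> i) (\<lambda>\<omega>. \<Sum>i. \<omega> i) sequentially"
    by (rule Weierstrass_m_test[where M = "\<lambda>n. 2 * (1/2) ^ n"]) (auto intro: norm_digit_le codesD)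
  then show ?thesis
    unfolding point_def
    by (rule uniform_limit_theorem[rotated])
      (auto intro!: always_eventually continuous_on_sum continuous_on_subset[OF continuous_on_product_coordinates])
qed

lemma compact_point_image:
  assumes "\<And>n. D n \<subseteq> digits n"
  shows "compact (point ` PiE UNIV D)"
proof (rule compact_continuous_image)
  have "PiE UNIV D \<subseteq> codes" using assms by (auto simp: codes_def PiE_iff)
  then show "continuous_on (PiE UNIV D) point" by (rule continuous_on_subset[OF continuous_on_point])
  show "compact (PiE UNIV D)" using assms by (intro compact_PiE_finite) (meson finite_digits finite_subset)
qed

section \<open>The Cantor measure\<close>

definition code_measure :: "(nat \<Rightarrow> real^2) measure" where
  "code_measure = PiM UNIV (\<lambda>n. uniform_count_measure (digits n))"

definition mu :: "(real^2) measure" where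
  "mu = distr code_measure borel point"

definition mass :: "nat \<Rightarrow> real" where
  "mass n = 2 ^ (b0 + n + 1) * side n"

lemma mass_pos [simp]: "mass n > 0"
  by (simp add: mass_def)

lemma prob_space_digits: "prob_space (uniform_count_measure (digits n))"
  by (intro prob_space_uniform_count_measure) auto

sublocale codes: prob_space code_measure
  unfolding code_measure_def by (intro prob_space_PiM prob_space_digits)

lemma space_code_measure [simp]: "space code_measure = codes"
  by (simp add: code_measure_def space_PiM codes_def space_uniform_count_measure)

lemma sets_cylinder:
  assumes "finite J" "\<And>i. i \<in> J \<Longrightarrow> A i \<subseteq> digits i"
  shows "{\<omega> \<in> codes. \<forall>i\<in>J. \<omega> i \<in> A i} \<in> sets code_measure"
proof -
  have "{\<omega> \<in> codes. \<forall>i\<in>J. \<omega> i \<in> A i} =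
      prod_emb UNIV (\<lambda>n. uniform_count_measure (digits n)) J (PiE J A)"
    unfolding prod_emb_def using assms
    by (auto simp: space_PiM codes_def PiE_iff restrict_def extensional_def space_uniform_count_measure)
  also have "\<dots> \<in> sets code_measure"
    unfolding code_measure_def using assms
    by (intro sets_PiM_I) (auto simp: sets_uniform_count_measure)
  finally show ?thesis .
qed

lemma measure_cylinder:
  assumes "finite J" "\<And>i. i \<in> J \<Longrightarrow> A i \<subseteq> digits i"
  shows "measure code_measure {\<omega> \<in> codes. \<forall>i\<in>J. \<omega> i \<in> A i} = (\<Prod>i\<in>J. real (card (A i)) / real (card (digits i)))"
proof -
  interpret product_prob_space "\<lambda>n. uniform_count_measure (digits n)" UNIV
    by (intro product_prob_spaceI prob_space_digits)
  have "emeasure code_measure {\<omega> \<in> codes. \<forall>i\<in>J. \<omega> i \<in> A i}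
      = (\<Prod>i\<in>J. emeasure (uniform_count_measure (digits i)) (A i))"
    using emeasure_PiM_Collect[of J A] assms
    by (simp flip: code_measure_def space_code_measure add: sets_uniform_count_measure)
  also have "\<dots> = (\<Prod>i\<in>J. ennreal (real (card (A i)) / real (card (digits i))))"
    using assms by (intro prod.cong) (auto simp: emeasure_uniform_count_measure)
  also have "\<dots> = ennreal (\<Prod>i\<in>J. real (card (A i)) / real (card (digits i)))"
    by (simp add: prod_ennreal)
  finally show ?thesis by (simp add: measure_def prod_nonneg)
qed

text \<open>Mass is split equally among \<open>2 ^ (step_exp n - 1)\<close> children while the side
  shrinks by \<open>2 ^ step_exp n\<close>, so the quotient of mass and side doubles in each
  generation.\<close>

lemma mass_eq_prod: "mass n = (\<Prod>i<n. 1 / real (card (digits i)))"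
proof (induction n)
  case 0
  show ?case by (simp add: mass_def side_def power_one_over)
next
  case (Suc n)
  have "2 * (2::real) ^ (step_exp n - 1) = 2 ^ Suc (step_exp n - 1)" by simp
  also have "Suc (step_exp n - 1) = step_exp n" using step_exp_ge_3[of n] by simp
  finally have "(2::real) ^ step_exp n = 2 * 2 ^ (step_exp n - 1)" by simp
  then have "mass (Suc n) = mass n / real (card (digits n))"
    by (simp add: mass_def side_Suc card_digits power_one_over)
  then show ?case using Suc by simp
qed

text \<open>\<open>T\<close> selects some of the children of one fixed square of generation
  \<open>n\<close>; all of them have the same mass.\<close>

lemma sets_cylinder_prefix:
  assumes "\<omega>0 \<in> codes" "T \<subseteq> digits n"
  shows "{\<omega> \<in> codes. (\<forall>i<n. \<omega> i = \<omega>0 i) \<and> \<omega> n \<in> T} \<in> sets code_measure"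
    and "measure code_measure {\<omega> \<in> codes. (\<forall>i<n. \<omega> i = \<omega>0 i) \<and> \<omega> n \<in> T} = mass (Suc n) * real (card T)"
proof -
  define A where "A i = (if i < n then {\<omega>0 i} else T)" for i
  have eq: "{\<omega> \<in> codes. (\<forall>i<n. \<omega> i = \<omega>0 i) \<and> \<omega> n \<in> T} = {\<omega> \<in> codes. \<forall>i\<in>{..n}. \<omega> i \<in> A i}"
    by (auto simp: A_def le_less)
  have A: "A i \<subseteq> digits i" if "i \<in> {..n}" for i
    using that assms codesD by (auto simp: A_def le_less)
  show "{\<omega> \<in> codes. (\<forall>i<n. \<omega> i = \<omega>0 i) \<and> \<omega> n \<in> T} \<in> sets code_measure"
    unfolding eq by (intro sets_cylinder A) auto
  have "measure code_measure {\<omega> \<in> codes. (\<forall>i<n. \<omega> i = \<omega>0 i) \<and> \<omega> n \<in> T}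
      = (\<Prod>i\<in>{..n}. real (card (A i)) / real (card (digits i)))"
    unfolding eq by (intro measure_cylinder A) auto
  also have "\<dots> = (\<Prod>i<n. 1 / real (card (digits i))) * (real (card T) / real (card (digits n)))"
    by (simp add: lessThan_Suc_atMost[symmetric] A_def)
  also have "\<dots> = mass (Suc n) * real (card T)"
    unfolding mass_eq_prod by simp
  finally show "measure code_measure {\<omega> \<in> codes. (\<forall>i<n. \<omega> i = \<omega>0 i) \<and> \<omega> n \<in> T} = mass (Suc n) * real (card T)" .
qed

text \<open>Half of the digits of every generation lie in the centre row, and the generations are
  independent.\<close>

lemma measure_central_codes:
  "measure code_measure {\<omega> \<in> codes. \<forall>i\<in>{n..<n + k}. \<omega> i $ 2 = 0} = (1/2) ^ k"
proof -
  define A where "A i = {v \<in> digits i. v $ 2 = 0}" for i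
  have cA: "real (card (A i)) / real (card (digits i)) = 1/2" for i
  proof -
    have "A i = digit i 0 ` {..<row_card i 0}"
    proof
      show "A i \<subseteq> digit i 0 ` {..<row_card i 0}"
      proof
        fix v assume v: "v \<in> A i"
        then obtain r p where rp: "r \<le> rows i" "p < row_card i r" "v = digit i r p"
          by (auto simp: A_def elim: digits_cases)
        then have "height i r = 0" using v by (simp add: A_def)
        then have "r = 0" using height_pos[of r i] by (cases "r = 0") auto
        then show "v \<in> digit i 0 ` {..<row_card i 0}" using rp by auto
      qed
    qed (auto simp: A_def digit_in_digits)
    moreover have "inj_on (digit i 0) {..<row_card i 0}"
      by (auto simp: inj_on_def dest: digit_inj)
    ultimately have "card (A i) = 2 ^ (step_exp i - 2)"
      by (simp add: card_image row_card_def gap_exp_def)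
    moreover have "step_exp i - 1 = Suc (step_exp i - 2)" using step_exp_ge_3[of i] by simp
    ultimately show ?thesis by (simp add: card_digits)
  qed
  have "{\<omega> \<in> codes. \<forall>i\<in>{n..<n + k}. \<omega> i $ 2 = 0} = {\<omega> \<in> codes. \<forall>i\<in>{n..<n + k}. \<omega> i \<in> A i}"
    using codesD by (auto simp: A_def)
  then have "measure code_measure {\<omega> \<in> codes. \<forall>i\<in>{n..<n + k}. \<omega> i $ 2 = 0}
      = (\<Prod>i\<in>{n..<n + k}. real (card (A i)) / real (card (digits i)))"
    by (simp only:) (intro measure_cylinder, auto simp: A_def)
  also have "\<dots> = (1/2) ^ k" by (simp add: cA)
  finally show ?thesis .
qed

lemma measurable_point [measurable]: "point \<in> borel_measurable code_measure"
proof -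
  have "(\<lambda>\<omega>. \<omega> i) \<in> borel_measurable code_measure" for i
  proof (rule measurable_compose)
    show "(\<lambda>\<omega>. \<omega> i) \<in> measurable code_measure (uniform_count_measure (digits i))"
      unfolding code_measure_def by (rule measurable_component_singleton) simp
    show "(\<lambda>v. v) \<in> measurable (uniform_count_measure (digits i)) borel"
      by (auto simp: measurable_def sets_uniform_count_measure space_uniform_count_measure)
  qed
  then show ?thesis unfolding point_def by measurable
qed

lemma sets_mu [simp, measurable_cong]: "sets mu = sets borel"
  by (simp add: mu_def)

sublocale mu: prob_space mu
  unfolding mu_def by (rule codes.prob_space_distr) simp

lemma sets_point_preimage [measurable]:
  "A \<in> sets borel \<Longrightarrow> {\<omega> \<in> codes. point \<omega> \<in> A} \<in> sets code_measure"
  using measurable_sets[OF measurable_point, of A] by (simp add: vimage_def Int_def conj_commute)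

lemma measure_mu:
  assumes "A \<in> sets borel"
  shows "measure mu A = measure code_measure {\<omega> \<in> codes. point \<omega> \<in> A}"
  using assms by (simp add: mu_def measure_distr vimage_def Int_def conj_commute)

lemma set_integral_mu:
  fixes g :: "real^2 \<Rightarrow> real"
  assumes [measurable]: "A \<in> sets borel" "g \<in> borel_measurable borel"
  shows "(LINT y:A|mu. g y) = (LINT \<omega>|code_measure. indicator A (point \<omega>) * g (point \<omega>))"
  unfolding set_lebesgue_integral_def mu_def by (subst integral_distr) auto

lemma set_integral_mu_le:
  fixes g :: "real^2 \<Rightarrow> real"
  assumes [measurable]: "A \<in> sets borel" "g \<in> borel_measurable borel"
    and c: "\<And>\<omega>. \<omega> \<in> codes \<Longrightarrow> point \<omega> \<in> A \<Longrightarrow> g (point \<omega>) \<le> c" and "c \<ge> 0"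
  shows "(LINT y:A|mu. g y) \<le> c * measure mu A"
proof -
  have "(LINT y:A|mu. g y) \<le> (LINT \<omega>|code_measure. c * indicator {\<omega> \<in> codes. point \<omega> \<in> A} \<omega>)"
    unfolding set_integral_mu[OF assms(1,2)]
  proof (rule integral_mono')
    show "integrable code_measure (\<lambda>\<omega>. c * indicat_real {\<omega> \<in> codes. point \<omega> \<in> A} \<omega>)"
      by (intro integrable_mult_right integrable_real_indicator) (auto simp: codes.emeasure_eq_measure)
  qed (use c \<open>c \<ge> 0\<close> in \<open>auto simp: indicator_def\<close>)
  also have "\<dots> = c * measure mu A"
  proof -
    have "{\<omega> \<in> codes. point \<omega> \<in> A} \<inter> codes = {\<omega> \<in> codes. point \<omega> \<in> A}" by auto
    then show ?thesis by (simp add: measure_mu)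
  qed
  finally show ?thesis .
qed

section \<open>Linear densities of the rows and sums of squared heights\<close>

definition row_density :: "nat \<Rightarrow> nat \<Rightarrow> real" where
  "row_density n i = (if i = 0 then 2 ^ (b0 + n) else (1/2) ^ (b0 + n))"

lemma mass_eq_density: "mass (Suc n) = row_density n i * gap n i"
proof (cases "i = 0")
  case True
  then show ?thesis by (simp add: row_density_def mass_def gap_def gap_exp_def power_add)
next
  case False
  define m where "m = b0 + n"
  have "(1/2::real) ^ m * 2 ^ m = 1" by (simp add: power_one_over)
  then have "(1/2::real) ^ m * (2 ^ m * (2 ^ m * 4)) = 2 ^ m * 4" by simp
  moreover have "2 * m + 2 = m + (m + 2)" by simp
  ultimately have *: "(1/2::real) ^ m * 2 ^ (2 * m + 2) = 2 ^ (m + 2)"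
    by (simp only: power_add power2_eq_square)
  have "mass (Suc n) = 2 ^ (m + 2) * side (Suc n)" by (simp add: mass_def m_def)
  also have "\<dots> = (1/2) ^ m * (2 ^ (2 * m + 2) * side (Suc n))" unfolding *[symmetric] by (rule mult.assoc)
  also have "\<dots> = row_density n i * gap n i"
    unfolding row_density_def gap_def gap_exp_def m_def using False by simp
  finally show ?thesis .
qed

lemma gap_le_last_height: "2 * gap n i \<le> height n (rows n)"
proof -
  have "(2::real) ^ gap_exp n i \<le> 2 ^ (2 * (b0 + n) + 2)"
    by (intro power_increasing) (auto simp: gap_exp_def)
  then have "2 ^ gap_exp n i * side (Suc n) \<le> 2 ^ (2 * (b0 + n) + 2) * side (Suc n)"
    by (intro mult_right_mono) (auto simp: less_imp_le)
  then show ?thesis unfolding height_last gap_def by linarith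
qed

lemma sum_height_squares_le:
  assumes "B \<ge> 0"
  shows "(\<Sum>i\<in>{1..m}. if height n i < B then (height n i)\<^sup>2 else 0) \<le> 16/15 * B\<^sup>2"
proof -
  \<comment> \<open>Telescoping: \<open>h\<^sub>i\<^sub>+\<^sub>1 = h\<^sub>i / 4\<close> gives \<open>h\<^sub>i\<^sup>2 = 16/15 (h\<^sub>i\<^sup>2 - h\<^sub>i\<^sub>+\<^sub>1\<^sup>2)\<close>.\<close>
  define g where "g i = min ((height n i)\<^sup>2) (B\<^sup>2)" for i
  have "(\<Sum>i\<in>{1..m}. if height n i < B then (height n i)\<^sup>2 else 0) \<le> (\<Sum>i\<in>{1..m}. 16/15 * (g i - g (Suc i)))"
  proof (rule sum_mono)
    fix i assume "i \<in> {1..m}"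
    then have h: "height n (Suc i) = height n i / 4" by (auto simp: height_def)
    have le: "height n (Suc i) \<le> height n i" unfolding h using height_nonneg[of n i] by simp
    show "(if height n i < B then (height n i)\<^sup>2 else 0) \<le> 16/15 * (g i - g (Suc i))"
    proof (cases "height n i < B")
      case True
      then have "(height n i)\<^sup>2 \<le> B\<^sup>2" "(height n (Suc i))\<^sup>2 \<le> B\<^sup>2"
        using le height_nonneg[of n i] height_nonneg[of n "Suc i"] by (auto intro!: power_mono)
      then have "g i = (height n i)\<^sup>2" "g (Suc i) = (height n (Suc i))\<^sup>2" by (simp_all add: g_def)
      then have "16/15 * (g i - g (Suc i)) = (height n i)\<^sup>2" unfolding h by (simp add: power_divide)
      then show ?thesis by simp
    next
      case False
      have "(height n (Suc i))\<^sup>2 \<le> (height n i)\<^sup>2" using le height_nonneg by (intro power_mono)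
      then have "g (Suc i) \<le> g i" by (simp add: g_def)
      then show ?thesis using False by simp
    qed
  qed
  also have "\<dots> = 16/15 * (\<Sum>i\<in>{1..m}. g i - g (Suc i))" by (simp add: sum_distrib_left)
  also have "(\<Sum>i\<in>{1..m}. g i - g (Suc i)) = g 1 - g (Suc m)"
    by (induction m) auto
  also have "16/15 * (g 1 - g (Suc m)) \<le> 16/15 * B\<^sup>2"
  proof -
    have "g 1 \<le> B\<^sup>2" "0 \<le> g (Suc m)" by (simp_all add: g_def)
    then have "g 1 - g (Suc m) \<le> B\<^sup>2" by linarith
    then show ?thesis by simp
  qed
  finally show ?thesis .
qed

section \<open>One generation of scales\<close>

text \<open>The side \<open>l\<close> is at least that of generation \<open>Suc n\<close> and at
  most half that of generation \<open>n\<close>. The corners of the dyadic square and of the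
  construction square around the point both lie on the grid of step \<open>l\<close>, so relative
  positions are exact.\<close>

context
  fixes \<omega>0 :: "nat \<Rightarrow> real^2" and n j :: nat and l x1 x2 c1 c2
  assumes \<omega>0: "\<omega>0 \<in> codes" and j: "side_exp n < j" "j \<le> side_exp (Suc n)"
  defines "l \<equiv> (1/2::real) ^ j"
    and "x1 \<equiv> dyadic_floor j (point \<omega>0 $ 1)" and "x2 \<equiv> dyadic_floor j (point \<omega>0 $ 2)"
    and "c1 \<equiv> corner n \<omega>0 $ 1" and "c2 \<equiv> corner n \<omega>0 $ 2"
begin

lemma l_pos: "l > 0"
  by (simp add: l_def)

lemma l_le_side: "2 * l \<le> side n"
proof -
  have "(1/2::real) ^ j \<le> (1/2) ^ Suc (side_exp n)" using j by (intro power_decreasing) auto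
  then show ?thesis by (simp add: l_def side_def)
qed

lemma side_le_l: "side (Suc n) \<le> l"
  unfolding l_def side_def using j by (intro power_decreasing) auto

lemma dyadic_fine: "dyadic j u \<Longrightarrow> dyadic (side_exp (Suc n)) u"
  using j by (auto intro: dyadic_mono)

lemma dyadic_coarse: "dyadic (side_exp n) u \<Longrightarrow> dyadic j u"
  using j by (auto intro: dyadic_mono)

lemma dyadic_l: "dyadic j l"
  unfolding l_def by (rule dyadic_power) simp

lemma dyadic_x: "dyadic j x1" "dyadic j x2"
  by (simp_all add: x1_def x2_def dyadic_dyadic_floor)

lemma dyadic_c: "dyadic j c1" "dyadic j c2"
  by (simp_all add: c1_def c2_def dyadic_coarse dyadic_corner \<omega>0)

lemma x_bounds: "c1 \<le> x1" "c2 \<le> x2" "x1 + l \<le> c1 + side n"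
proof -
  show "c1 \<le> x1" "c2 \<le> x2"
    unfolding x1_def x2_def using point_bounds[OF \<omega>0] dyadic_c
    by (auto intro!: dyadic_le_floor simp: c1_def c2_def)
  have "x1 < c1 + side n"
    using dyadic_floor_le[of j "point \<omega>0 $ 1"] point_bounds(2)[OF \<omega>0, where n = n and k = 1]
    by (simp add: x1_def c1_def)
  moreover have "dyadic j (c1 + side n)"
    using j by (intro dyadic_add dyadic_c) (auto simp: side_def intro!: dyadic_power)
  ultimately show "x1 + l \<le> c1 + side n"
    unfolding l_def by (intro dyadic_less_imp_add_le dyadic_x)
qed

lemma mem_square: "y \<in> dyadic_square_at j (point \<omega>0) \<longleftrightarrow>
    x1 \<le> y $ 1 \<and> y $ 1 < x1 + l \<and> x2 \<le> y $ 2 \<and> y $ 2 < x2 + l"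
  by (auto simp: mem_dyadic_square_at forall_2 x1_def x2_def l_def)

lemma mem_triple: "y \<in> triple (dyadic_square_at j (point \<omega>0)) \<longleftrightarrow>
    x1 - l \<le> y $ 1 \<and> y $ 1 < x1 + 2 * l \<and> x2 - l \<le> y $ 2 \<and> y $ 2 < x2 + 2 * l"
  by (auto simp: mem_triple_dyadic_square_at forall_2 x1_def x2_def l_def)

lemma point_in_square: "x1 \<le> point \<omega>0 $ 1" "point \<omega>0 $ 1 < x1 + l" "x2 \<le> point \<omega>0 $ 2" "point \<omega>0 $ 2 < x2 + l"
  by (simp_all add: x1_def x2_def l_def dyadic_floor_le dyadic_floor_gt)

text \<open>Points of the triple are within \<open>2 * l \<le> side n\<close> of the given point in
  each coordinate, strictly. Different squares of generation \<open>n\<close> are too far apart for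
  the triple to see two of them.\<close>

lemma prefix_eq:
  assumes "\<omega> \<in> codes" "point \<omega> \<in> triple (dyadic_square_at j (point \<omega>0))" "i < n"
  shows "\<omega> i = \<omega>0 i"
proof (rule ccontr)
  assume "\<omega> i \<noteq> \<omega>0 i"
  then obtain k where k: "side n \<le> \<bar>point \<omega> $ k - point \<omega>0 $ k\<bar>"
    using points_separated[OF assms(1) \<omega>0 assms(3)] by blast
  have "\<bar>point \<omega> $ 1 - point \<omega>0 $ 1\<bar> < 2 * l" "\<bar>point \<omega> $ 2 - point \<omega>0 $ 2\<bar> < 2 * l"
    using assms(2) point_in_square unfolding mem_triple by linarith+
  then show False using k l_le_side exhaust_2[of k] by auto
qed

lemma child_bounds:
  assumes "\<omega> \<in> codes" "\<And>i. i < n \<Longrightarrow> \<omega> i = \<omega>0 i"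
  shows "c1 + \<omega> n $ 1 \<le> point \<omega> $ 1" "point \<omega> $ 1 < c1 + \<omega> n $ 1 + side (Suc n)"
    "c2 + \<omega> n $ 2 \<le> point \<omega> $ 2" "point \<omega> $ 2 < c2 + \<omega> n $ 2 + side (Suc n)"
proof -
  have "corner n \<omega> = corner n \<omega>0" using assms by (intro corner_cong)
  then show "c1 + \<omega> n $ 1 \<le> point \<omega> $ 1" "point \<omega> $ 1 < c1 + \<omega> n $ 1 + side (Suc n)"
    "c2 + \<omega> n $ 2 \<le> point \<omega> $ 2" "point \<omega> $ 2 < c2 + \<omega> n $ 2 + side (Suc n)"
    using point_bounds[OF assms(1), where n = "Suc n" and k = 1] point_bounds[OF assms(1), where n = "Suc n" and k = 2]
    by (simp_all add: corner_Suc c1_def c2_def)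
qed

text \<open>The triple spans exactly \<open>3 * q\<close> gaps of the row, where
  \<open>l = gap n i * q\<close>, and each gap carries one child of mass
  \<open>row_density n i * gap n i\<close>. Grid alignment keeps boundary children out of the
  count.\<close>

lemma measure_triple_row_le:
  assumes i: "i \<le> rows n" and g: "gap n i \<le> l"
  shows "{\<omega> \<in> codes. point \<omega> \<in> triple (dyadic_square_at j (point \<omega>0)) \<and> \<omega> n $ 2 = height n i} \<in> sets code_measure"
      (is "?A \<in> _")
    and "measure code_measure {\<omega> \<in> codes. point \<omega> \<in> triple (dyadic_square_at j (point \<omega>0)) \<and> \<omega> n $ 2 = height n i}
      \<le> 3 * l * row_density n i"
proof -
  define e where "e = side_exp (Suc n) - gap_exp n i"
  have ge: "gap n i = (1/2) ^ e" by (simp add: e_def gap_eq_power)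
  have je: "j \<le> e"
    using g unfolding ge l_def by simp
  define q where "q = (2::nat) ^ (e - j)"
  have "(2::real) ^ e = 2 ^ j * 2 ^ (e - j)" using je by (simp flip: power_add)
  then have lq: "l = gap n i * real q"
    by (simp add: ge l_def q_def power_one_over)
  define lo where "lo = x1 - c1 - l"
  have "dyadic e lo"
    unfolding lo_def by (rule dyadic_mono[OF _ je]) (intro dyadic_diff dyadic_x dyadic_c dyadic_l)
  then obtain z :: int where z: "lo = gap n i * of_int z" by (auto simp: dyadic_def ge mult.commute)
  define P where "P = {p::nat. lo \<le> gap n i * real p \<and> gap n i * real p < lo + gap n i * real (3 * q)}"
  have P: "finite P" "card P \<le> 3 * q"
    using card_multiples_in_interval(1,2)[OF gap_pos z, of "3 * q"] by (auto simp: P_def)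
  define T where "T = digit n i ` (P \<inter> {..<row_card n i})"
  have T: "T \<subseteq> digits n" using i by (auto simp: T_def digit_in_digits)
  have "card T \<le> card (P \<inter> {..<row_card n i})" unfolding T_def by (intro card_image_le) auto
  also have "\<dots> \<le> card P" using P by (intro card_mono) auto
  finally have cT: "card T \<le> 3 * q" using P by simp
  have sub: "?A \<subseteq> {\<omega> \<in> codes. (\<forall>i<n. \<omega> i = \<omega>0 i) \<and> \<omega> n \<in> T}"
  proof
    fix \<omega> assume "\<omega> \<in> ?A"
    then have \<omega>: "\<omega> \<in> codes" "point \<omega> \<in> triple (dyadic_square_at j (point \<omega>0))" "\<omega> n $ 2 = height n i" by auto
    have pre: "\<And>i. i < n \<Longrightarrow> \<omega> i = \<omega>0 i" using prefix_eq[OF \<omega>(1,2)] .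
    obtain i' p where ip: "i' \<le> rows n" "p < row_card n i'" "\<omega> n = digit n i' p"
      using codesD[OF \<omega>(1), of n] by (rule digits_cases)
    then have "i' = i" using \<omega>(3) height_inj i by simp
    note cb = child_bounds[OF \<omega>(1) pre]
    have d: "dyadic (side_exp (Suc n)) (c1 + \<omega> n $ 1)" "dyadic (side_exp (Suc n)) (x1 - l)"
      by (intro dyadic_add dyadic_fine[OF dyadic_c(1)] dyadic_digit codesD \<omega>(1))
         (intro dyadic_fine dyadic_diff dyadic_x dyadic_l)
    \<comment> \<open>A child that starts left of the grid line \<open>x1 - l\<close> also ends
      there at the latest, so it has no point in the triple.\<close>
    have "x1 - l \<le> c1 + \<omega> n $ 1"
    proof (rule ccontr)
      assume "\<not> ?thesis"
      then have "c1 + \<omega> n $ 1 + side (Suc n) \<le> x1 - l"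
        using dyadic_less_imp_add_le[OF d] by (simp add: side_def)
      then show False using cb \<omega>(2) unfolding mem_triple by linarith
    qed
    moreover have "c1 + \<omega> n $ 1 < x1 + 2 * l" using cb \<omega>(2) unfolding mem_triple by linarith
    ultimately have "p \<in> P" using ip \<open>i' = i\<close> lq by (simp add: P_def lo_def algebra_simps)
    then show "\<omega> \<in> {\<omega> \<in> codes. (\<forall>i<n. \<omega> i = \<omega>0 i) \<and> \<omega> n \<in> T}"
      using pre \<omega> ip \<open>i' = i\<close> by (auto simp: T_def)
  qed
  have "{\<omega> \<in> codes. \<forall>k\<in>{n}. \<omega> k \<in> {v \<in> digits n. v $ 2 = height n i}} \<in> sets code_measure"
    by (intro sets_cylinder) auto
  moreover have "?A = {\<omega> \<in> codes. point \<omega> \<in> triple (dyadic_square_at j (point \<omega>0))} \<inter>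
      {\<omega> \<in> codes. \<forall>k\<in>{n}. \<omega> k \<in> {v \<in> digits n. v $ 2 = height n i}}"
    using codesD by auto
  ultimately show "?A \<in> sets code_measure" by auto
  have "measure code_measure ?A \<le> measure code_measure {\<omega> \<in> codes. (\<forall>i<n. \<omega> i = \<omega>0 i) \<and> \<omega> n \<in> T}"
    by (intro codes.finite_measure_mono sub sets_cylinder_prefix \<omega>0 T)
  also have "\<dots> = mass (Suc n) * real (card T)" by (intro sets_cylinder_prefix \<omega>0 T)
  also have "\<dots> \<le> mass (Suc n) * real (3 * q)"
    using cT by (intro mult_left_mono of_nat_mono) (auto simp: less_imp_le)
  also have "\<dots> = 3 * l * row_density n i" by (simp add: lq mass_eq_density[of n i])
  finally show "measure code_measure ?A \<le> 3 * l * row_density n i" .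
qed

text \<open>The same count from below, over a window of width \<open>l\<close>. The set
  \<open>B\<close> is left general because both the square and its triple are used.\<close>

lemma measure_row_ge:
  assumes i: "i \<le> rows n" and g: "gap n i \<le> l" and B: "B \<in> sets borel"
    and sub: "\<And>y. x1 \<le> y $ 1 \<Longrightarrow> y $ 1 < x1 + l \<Longrightarrow> c2 + height n i \<le> y $ 2 \<Longrightarrow>
      y $ 2 < c2 + height n i + side (Suc n) \<Longrightarrow> y \<in> B"
  shows "l * row_density n i \<le> measure mu B"
proof -
  define e where "e = side_exp (Suc n) - gap_exp n i"
  have ge: "gap n i = (1/2) ^ e" by (simp add: e_def gap_eq_power)
  have je: "j \<le> e"
    using g unfolding ge l_def by simp
  define q where "q = (2::nat) ^ (e - j)"
  have "(2::real) ^ e = 2 ^ j * 2 ^ (e - j)" using je by (simp flip: power_add)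
  then have lq: "l = gap n i * real q"
    by (simp add: ge l_def q_def power_one_over)
  define lo where "lo = x1 - c1"
  have "dyadic e lo"
    unfolding lo_def by (rule dyadic_mono[OF _ je]) (intro dyadic_diff dyadic_x dyadic_c)
  then obtain z :: int where z: "lo = gap n i * of_int z" by (auto simp: dyadic_def ge mult.commute)
  have "0 \<le> lo" using x_bounds by (simp add: lo_def)
  then have z0: "z \<ge> 0" unfolding z using gap_pos[of n i] by (simp add: zero_le_mult_iff)
  define P where "P = {p::nat. lo \<le> gap n i * real p \<and> gap n i * real p < lo + gap n i * real q}"
  have P: "card P = q"
    using card_multiples_in_interval(3)[OF gap_pos z z0, of q] by (auto simp: P_def)
  \<comment> \<open>All \<open>q\<close> positions are present in the row, since the dyadic square
    does not pass the right edge of the parent.\<close>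
  have Prow: "p < row_card n i" if "p \<in> P" for p
  proof -
    have "gap n i * real p < lo + l" using that lq by (simp add: P_def)
    also have "\<dots> \<le> side n" using x_bounds by (simp add: lo_def)
    also have "\<dots> = gap n i * real (row_card n i)" by (simp add: gap_row_card)
    finally show ?thesis by simp
  qed
  define T where "T = digit n i ` P"
  have T: "T \<subseteq> digits n" using i Prow by (auto simp: T_def digit_in_digits)
  have cT: "card T = q"
    unfolding T_def using P i by (subst card_image) (auto simp: inj_on_def dest: digit_inj)
  have subs: "{\<omega> \<in> codes. (\<forall>i<n. \<omega> i = \<omega>0 i) \<and> \<omega> n \<in> T} \<subseteq> {\<omega> \<in> codes. point \<omega> \<in> B}"
  proof
    fix \<omega> assume "\<omega> \<in> {\<omega> \<in> codes. (\<forall>i<n. \<omega> i = \<omega>0 i) \<and> \<omega> n \<in> T}"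
    then have \<omega>: "\<omega> \<in> codes" "\<And>i. i < n \<Longrightarrow> \<omega> i = \<omega>0 i" "\<omega> n \<in> T" by auto
    then obtain p where p: "p \<in> P" "\<omega> n = digit n i p" by (auto simp: T_def)
    note cb = child_bounds[OF \<omega>(1,2)]
    have d: "dyadic (side_exp (Suc n)) (c1 + \<omega> n $ 1)" "dyadic (side_exp (Suc n)) (x1 + l)"
      by (intro dyadic_add dyadic_fine[OF dyadic_c(1)] dyadic_digit codesD \<omega>(1))
         (intro dyadic_fine dyadic_add dyadic_x dyadic_l)
    have 1: "x1 \<le> c1 + \<omega> n $ 1" using p by (simp add: P_def lo_def)
    have "c1 + \<omega> n $ 1 < x1 + l" using p lq by (simp add: P_def lo_def)
    then have 2: "c1 + \<omega> n $ 1 + side (Suc n) \<le> x1 + l"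
      using dyadic_less_imp_add_le[OF d] by (simp add: side_def)
    have "point \<omega> \<in> B"
      using cb 1 2 p by (intro sub) auto
    then show "\<omega> \<in> {\<omega> \<in> codes. point \<omega> \<in> B}" using \<omega> by simp
  qed
  have "l * row_density n i = mass (Suc n) * real (card T)"
    by (simp add: cT lq mass_eq_density[of n i])
  also have "\<dots> = measure code_measure {\<omega> \<in> codes. (\<forall>i<n. \<omega> i = \<omega>0 i) \<and> \<omega> n \<in> T}"
    by (intro sets_cylinder_prefix(2)[symmetric] \<omega>0 T)
  also have "\<dots> \<le> measure mu B"
    unfolding measure_mu[OF B] by (intro codes.finite_measure_mono subs sets_point_preimage B)
  finally show ?thesis .
qed

text \<open>Grid alignment places the whole square of generation \<open>Suc n\<close> around the
  point inside the dyadic square.\<close>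

lemma measure_square_ge: "mass (Suc n) \<le> measure mu (dyadic_square_at j (point \<omega>0))"
proof -
  have T: "{\<omega>0 n} \<subseteq> digits n" using codesD[OF \<omega>0] by simp
  have "{\<omega> \<in> codes. (\<forall>i<n. \<omega> i = \<omega>0 i) \<and> \<omega> n \<in> {\<omega>0 n}}
      \<subseteq> {\<omega> \<in> codes. point \<omega> \<in> dyadic_square_at j (point \<omega>0)}"
  proof
    fix \<omega> assume "\<omega> \<in> {\<omega> \<in> codes. (\<forall>i<n. \<omega> i = \<omega>0 i) \<and> \<omega> n \<in> {\<omega>0 n}}"
    then have \<omega>: "\<omega> \<in> codes" "\<And>i. i < n \<Longrightarrow> \<omega> i = \<omega>0 i" "\<omega> n = \<omega>0 n" by auto
    have "dyadic_floor j (point \<omega>0 $ k) \<le> point \<omega> $ k \<and> point \<omega> $ k < dyadic_floor j (point \<omega>0 $ k) + l" for k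
    proof -
      have c: "corner (Suc n) \<omega> = corner (Suc n) \<omega>0" using \<omega> by (intro corner_cong) (auto simp: less_Suc_eq)
      have d: "dyadic (side_exp (Suc n)) (corner (Suc n) \<omega>0 $ k)"
          "dyadic (side_exp (Suc n)) (dyadic_floor j (point \<omega>0 $ k))"
          "dyadic (side_exp (Suc n)) (dyadic_floor j (point \<omega>0 $ k) + l)"
        by (intro dyadic_corner \<omega>0 dyadic_fine dyadic_dyadic_floor dyadic_add dyadic_l)+
      show ?thesis
        using point_bounds[OF \<omega>(1), where n = "Suc n" and k = k] point_bounds[OF \<omega>0, where n = "Suc n" and k = k]
          dyadic_less_imp_add_le[OF d(1,2)] dyadic_less_imp_add_le[OF d(1,3)]
          dyadic_floor_le[of j "point \<omega>0 $ k"] dyadic_floor_gt[of "point \<omega>0 $ k" j]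
        unfolding c side_def l_def by linarith
    qed
    then show "\<omega> \<in> {\<omega> \<in> codes. point \<omega> \<in> dyadic_square_at j (point \<omega>0)}"
      using \<omega> by (simp add: mem_dyadic_square_at l_def)
  qed
  then have "measure code_measure {\<omega> \<in> codes. (\<forall>i<n. \<omega> i = \<omega>0 i) \<and> \<omega> n \<in> {\<omega>0 n}}
      \<le> measure mu (dyadic_square_at j (point \<omega>0))"
    unfolding measure_mu[OF dyadic_square_at_borel]
    by (intro codes.finite_measure_mono sets_point_preimage) auto
  then show ?thesis using sets_cylinder_prefix(2)[OF \<omega>0 T] by simp
qed

lemma l_ge_last_height_bounds:
  assumes "height n (rows n) \<le> l"
  shows "gap n i \<le> l" "8 * 4 ^ (b0 + n) * side (Suc n) \<le> l"
proof -
  show "gap n i \<le> l" using gap_le_last_height[of n i] gap_pos[of n i] assms by linarith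
  have "height n (rows n) = 8 * 4 ^ (b0 + n) * side (Suc n)"
    unfolding height_last by (simp add: power_add power_mult)
  then show "8 * 4 ^ (b0 + n) * side (Suc n) \<le> l" using assms by simp
qed

text \<open>The triple reaches less than \<open>3 * l\<close> above the bottom edge. Satellites
  there carry mass at most \<open>3 * l * (1/2) ^ (b0 + n)\<close> each, and their squared heights
  form a geometric series. The heavy centre row is only \<open>side (Suc n)\<close> thick, and
  \<open>4 ^ (b0 + n) * side (Suc n) \<le> l\<close> compensates its density.\<close>

lemma second_moment_le:
  assumes last: "height n (rows n) \<le> l" and x2: "x2 \<le> c2 + l"
  shows "(LINT y:triple (dyadic_square_at j (point \<omega>0))|mu. (y $ 2 - c2)\<^sup>2) \<le> 128 * (1/2) ^ (b0 + n) * l ^ 3"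
proof -
  define Q where "Q = triple (dyadic_square_at j (point \<omega>0))"
  have Qm [measurable]: "Q \<in> sets borel" by (simp add: Q_def)
  define A where "A i = {\<omega> \<in> codes. point \<omega> \<in> Q \<and> \<omega> n $ 2 = height n i}" for i
  have A: "A i \<in> sets code_measure" "measure code_measure (A i) \<le> 3 * l * row_density n i" if "i \<le> rows n" for i
    unfolding A_def Q_def using measure_triple_row_le[OF that l_ge_last_height_bounds(1)[OF last]] by auto
  \<comment> \<open>A bound for the squared distance to the bottom edge in row \<open>i\<close>, set
    to zero for rows beyond the reach of the triple.\<close>
  define w where "w i = (if height n i < 3 * l then (height n i + side (Suc n))\<^sup>2 else 0)" for i
  have w0: "w i \<ge> 0" for i by (simp add: w_def)
  have "(LINT y:Q|mu. (y $ 2 - c2)\<^sup>2)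
      = (LINT \<omega>|code_measure. indicator Q (point \<omega>) * (point \<omega> $ 2 - c2)\<^sup>2)"
    by (rule set_integral_mu) auto
  also have "\<dots> \<le> (LINT \<omega>|code_measure. (\<Sum>i\<le>rows n. w i * indicator (A i) \<omega>))"
  proof (rule integral_mono')
    show "integrable code_measure (\<lambda>\<omega>. \<Sum>i\<le>rows n. w i * indicat_real (A i) \<omega>)"
      using A by (intro Bochner_Integration.integrable_sum integrable_mult_right integrable_real_indicator)
        (auto simp: codes.emeasure_eq_measure)
    fix \<omega> assume "\<omega> \<in> space code_measure"
    then have \<omega>: "\<omega> \<in> codes" by simp
    show "indicat_real Q (point \<omega>) * (point \<omega> $ 2 - c2)\<^sup>2 \<le> (\<Sum>i\<le>rows n. w i * indicat_real (A i) \<omega>)"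
    proof (cases "point \<omega> \<in> Q")
      case True
      obtain i p where ip: "i \<le> rows n" "p < row_card n i" "\<omega> n = digit n i p"
        using codesD[OF \<omega>, of n] by (rule digits_cases)
      note cb = child_bounds[OF \<omega> prefix_eq[OF \<omega> True[unfolded Q_def]]]
      have "height n i < 3 * l" using True x2 cb ip unfolding Q_def mem_triple by simp
      moreover have "(point \<omega> $ 2 - c2)\<^sup>2 \<le> (height n i + side (Suc n))\<^sup>2"
        using cb ip height_nonneg[of n i] by (intro power_mono) auto
      ultimately have "indicat_real Q (point \<omega>) * (point \<omega> $ 2 - c2)\<^sup>2 \<le> w i * indicat_real (A i) \<omega>"
        using True \<omega> ip by (simp add: w_def A_def)
      also have "\<dots> \<le> (\<Sum>i\<le>rows n. w i * indicat_real (A i) \<omega>)"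
        using ip w0 by (intro member_le_sum) auto
      finally show ?thesis .
    qed (auto intro!: sum_nonneg mult_nonneg_nonneg w0)
  qed (auto intro!: sum_nonneg mult_nonneg_nonneg w0)
  also have "\<dots> = (\<Sum>i\<le>rows n. w i * measure code_measure (A i))"
  proof -
    have "A i \<inter> codes = A i" for i by (auto simp: A_def)
    then show ?thesis
      using A by (subst Bochner_Integration.integral_sum)
       (auto intro!: integrable_mult_right integrable_real_indicator simp: codes.emeasure_eq_measure)
  qed
  also have "\<dots> \<le> (\<Sum>i\<le>rows n. w i * (3 * l * row_density n i))"
    using A w0 by (intro sum_mono mult_left_mono) auto
  also have "\<dots> = w 0 * (3 * l * row_density n 0) + (\<Sum>i\<in>{1..rows n}. w i * (3 * l * row_density n i))"
    by (simp add: sum.atLeast1_atMost_eq sum.atMost_shift lessThan_Suc_atMost)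
  also have "(\<Sum>i\<in>{1..rows n}. w i * (3 * l * row_density n i))
      \<le> (\<Sum>i\<in>{1..rows n}. 12 * l * (1/2) ^ (b0 + n) * (if height n i < 3 * l then (height n i)\<^sup>2 else 0))"
  proof (rule sum_mono)
    fix i assume i: "i \<in> {1..rows n}"
    then have "0 < i" "i \<le> rows n" by auto
    then have "side (Suc n) \<le> height n i"
      using gap_le_height[of i n] gap_ge[of n i] side_pos[of "Suc n"] by linarith
    then have "(height n i + side (Suc n))\<^sup>2 \<le> (2 * height n i)\<^sup>2"
      using height_nonneg[of n i] side_pos[of "Suc n"] by (intro power_mono) linarith+
    then have "w i \<le> 4 * (if height n i < 3 * l then (height n i)\<^sup>2 else 0)"
      by (simp add: w_def power_mult_distrib)
    then have "w i * (3 * l * (1/2) ^ (b0 + n)) \<le> 4 * (if height n i < 3 * l then (height n i)\<^sup>2 else 0) * (3 * l * (1/2) ^ (b0 + n))"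
      using l_pos by (intro mult_right_mono) auto
    then show "w i * (3 * l * row_density n i)
        \<le> 12 * l * (1/2) ^ (b0 + n) * (if height n i < 3 * l then (height n i)\<^sup>2 else 0)"
      using i by (simp add: row_density_def mult_ac)
  qed
  also have "\<dots> = 12 * l * (1/2) ^ (b0 + n) * (\<Sum>i\<in>{1..rows n}. if height n i < 3 * l then (height n i)\<^sup>2 else 0)"
    by (simp only: sum_distrib_left)
  also have "\<dots> \<le> 12 * l * (1/2) ^ (b0 + n) * (16/15 * (3 * l)\<^sup>2)"
    using l_pos by (intro mult_left_mono sum_height_squares_le) auto
  also have "w 0 * (3 * l * row_density n 0) \<le> 3 * (1/2) ^ (b0 + n) * l ^ 3"
  proof -
    define m where "m = b0 + n"
    have "(4 ^ m * side (Suc n)) * side (Suc n) \<le> l * l"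
    proof (rule mult_mono)
      have "0 \<le> 4 ^ m * side (Suc n)" by (simp add: less_imp_le)
      then show "4 ^ m * side (Suc n) \<le> l"
        using l_ge_last_height_bounds(2)[OF last] unfolding m_def by linarith
    qed (use side_le_l l_pos in \<open>auto simp: less_imp_le\<close>)
    moreover have "(4::real) ^ m = 2 ^ m * 2 ^ m" by (simp flip: power_mult_distrib)
    ultimately have "2 ^ m * (2 ^ m * (side (Suc n))\<^sup>2) \<le> l\<^sup>2"
      by (simp add: power2_eq_square mult.assoc)
    then have "(1/2) ^ m * (2 ^ m * (2 ^ m * (side (Suc n))\<^sup>2)) \<le> (1/2) ^ m * l\<^sup>2"
      by (intro mult_left_mono) auto
    moreover have "(1/2::real) ^ m * 2 ^ m = 1" by (simp add: power_one_over)
    ultimately have "2 ^ m * (side (Suc n))\<^sup>2 \<le> (1/2) ^ m * l\<^sup>2"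
      by (simp add: mult.assoc[symmetric])
    then have "3 * l * (2 ^ m * (side (Suc n))\<^sup>2) \<le> 3 * l * ((1/2) ^ m * l\<^sup>2)"
      using l_pos by (intro mult_left_mono) auto
    moreover have "w 0 = (side (Suc n))\<^sup>2" using l_pos by (simp add: w_def)
    ultimately show ?thesis
      by (simp add: row_density_def m_def power3_eq_cube power2_eq_square mult_ac)
  qed
  finally have "(LINT y:Q|mu. (y $ 2 - c2)\<^sup>2) \<le> 3 * (1/2) ^ (b0 + n) * l ^ 3 + 12 * l * (1/2) ^ (b0 + n) * (16/15 * (3 * l)\<^sup>2)"
    by simp
  \<comment> \<open>The constant is 118.2, rounded up to 128 below.\<close>
  also have "\<dots> = (3 + 12 * (16/15) * 9) * ((1/2) ^ (b0 + n) * l ^ 3)"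
    by (simp add: power2_eq_square power3_eq_cube algebra_simps)
  also have "\<dots> \<le> 128 * ((1/2) ^ (b0 + n) * l ^ 3)"
    using l_pos by (intro mult_right_mono) auto
  finally show ?thesis by (simp add: Q_def mult.assoc)
qed

text \<open>The visible mass lies in a strip as thin as one child, so the squared beta number is at
  most \<open>(side (Suc n) / l)\<^sup>2\<close>. The weight \<open>l / mass (Suc n)\<close> cancels
  one factor, and what is left decays geometrically as \<open>l\<close> grows.\<close>

lemma jones_term_same_row:
  assumes same: "\<And>\<omega>. \<omega> \<in> codes \<Longrightarrow> point \<omega> \<in> triple (dyadic_square_at j (point \<omega>0)) \<Longrightarrow> \<omega> n $ 2 = \<omega>0 n $ 2"
  shows "ennreal ((beta2 mu (triple (dyadic_square_at j (point \<omega>0))))\<^sup>2) *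
      (ennreal l / emeasure mu (dyadic_square_at j (point \<omega>0)))
      \<le> ennreal ((1/2) ^ (b0 + n) * (side (Suc n) / l) / 4)"
proof -
  have "(LINT y:triple (dyadic_square_at j (point \<omega>0))|mu. (y $ 2 - (c2 + \<omega>0 n $ 2))\<^sup>2)
      \<le> (side (Suc n))\<^sup>2 * measure mu (triple (dyadic_square_at j (point \<omega>0)))"
  proof (rule set_integral_mu_le)
    fix \<omega> assume \<omega>: "\<omega> \<in> codes" "point \<omega> \<in> triple (dyadic_square_at j (point \<omega>0))"
    then show "(point \<omega> $ 2 - (c2 + \<omega>0 n $ 2))\<^sup>2 \<le> (side (Suc n))\<^sup>2"
      using child_bounds[OF \<omega>(1) prefix_eq[OF \<omega>]] same[OF \<omega>] by (intro power_mono) auto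
  qed auto
  from jones1_term_le[OF sets_mu mu.finite_measure_axioms this measure_square_ge mass_pos]
  have "ennreal ((beta2 mu (triple (dyadic_square_at j (point \<omega>0))))\<^sup>2) *
      (ennreal l / emeasure mu (dyadic_square_at j (point \<omega>0)))
      \<le> ennreal ((side (Suc n))\<^sup>2 / (l * mass (Suc n)))" unfolding l_def .
  also have "(side (Suc n))\<^sup>2 / (l * mass (Suc n)) = (1/2) ^ (b0 + n) * (side (Suc n) / l) / 4"
    using l_pos side_pos[of "Suc n"] by (simp add: mass_def power2_eq_square power_one_over power_add)
  finally show ?thesis .
qed

text \<open>The centre row alone gives the triple mass at least \<open>l * 2 ^ (b0 + n)\<close>;
  dividing the second moment by it leaves \<open>128 * (1/4) ^ (b0 + n) * l\<^sup>2\<close>. The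
  density \<open>\<rho>\<close> of the square itself will be that of the centre row or of a
  satellite.\<close>

lemma jones_term_centre_line:
  assumes last: "height n (rows n) \<le> l" and x2: "x2 \<le> c2 + l"
    and m: "\<rho> * l \<le> measure mu (dyadic_square_at j (point \<omega>0))" "\<rho> > 0"
  shows "ennreal ((beta2 mu (triple (dyadic_square_at j (point \<omega>0))))\<^sup>2) *
      (ennreal l / emeasure mu (dyadic_square_at j (point \<omega>0)))
      \<le> ennreal (128 * (1/4) ^ (b0 + n) / \<rho>)"
proof -
  define Q where "Q = triple (dyadic_square_at j (point \<omega>0))"
  have "l * row_density n 0 \<le> measure mu Q"
  proof (rule measure_row_ge)
    fix y :: "real^2"
    assume "x1 \<le> y $ 1" "y $ 1 < x1 + l" "c2 + height n 0 \<le> y $ 2" "y $ 2 < c2 + height n 0 + side (Suc n)"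
    then show "y \<in> Q" using x2 x_bounds l_pos side_le_l unfolding Q_def mem_triple height_0 by linarith
  qed (auto simp: Q_def l_ge_last_height_bounds[OF last])
  then have Q: "l * 2 ^ (b0 + n) \<le> measure mu Q" by (simp add: row_density_def)
  have e: "(1/2::real) ^ (b0 + n) = (1/4) ^ (b0 + n) * 2 ^ (b0 + n)"
    by (simp flip: power_mult_distrib)
  have "(LINT y:Q|mu. (y $ 2 - c2)\<^sup>2) \<le> 128 * (1/2) ^ (b0 + n) * l ^ 3"
    unfolding Q_def by (rule second_moment_le[OF last x2])
  also have "\<dots> = 128 * (1/4) ^ (b0 + n) * l\<^sup>2 * (l * 2 ^ (b0 + n))"
    unfolding e by (simp add: power2_eq_square power3_eq_cube)
  also have "\<dots> \<le> 128 * (1/4) ^ (b0 + n) * l\<^sup>2 * measure mu Q"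
    using Q by (intro mult_left_mono) auto
  finally have int: "(LINT y:Q|mu. (y $ 2 - c2)\<^sup>2) \<le> 128 * (1/4) ^ (b0 + n) * l\<^sup>2 * measure mu Q" .
  have "\<rho> * l > 0" using m l_pos by simp
  from jones1_term_le[OF sets_mu mu.finite_measure_axioms int[unfolded Q_def] m(1) this]
  have "ennreal ((beta2 mu (triple (dyadic_square_at j (point \<omega>0))))\<^sup>2) *
      (ennreal l / emeasure mu (dyadic_square_at j (point \<omega>0)))
      \<le> ennreal (128 * (1/4) ^ (b0 + n) * l\<^sup>2 / (l * (\<rho> * l)))" unfolding l_def .
  also have "128 * (1/4) ^ (b0 + n) * l\<^sup>2 / (l * (\<rho> * l)) = 128 * (1/4) ^ (b0 + n) / \<rho>"
    using l_pos m by (simp add: power2_eq_square)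
  finally show ?thesis .
qed

text \<open>Let \<open>h\<close> be the height of the satellite. As \<open>2 * l \<le> h\<close>,
  the square stands exactly on the satellite and the triple covers only heights from
  \<open>h / 2\<close> to \<open>2 * h\<close>. Other rows are at \<open>4 * h\<close> or above, or
  at \<open>h / 4\<close> or below, and children are at most \<open>h / 8\<close> thick.\<close>

lemma same_row_of_satellite:
  assumes i: "0 < i" "i \<le> rows n" "\<omega>0 n $ 2 = height n i" and small: "side_exp n + 2 * i < j"
    and \<omega>: "\<omega> \<in> codes" "point \<omega> \<in> triple (dyadic_square_at j (point \<omega>0))"
  shows "\<omega> n $ 2 = height n i"
proof -
  have h: "2 * l \<le> height n i"
  proof -
    have "(1/2::real) ^ j \<le> (1/2) ^ Suc (side_exp n + 2 * i)" using small by (intro power_decreasing) auto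
    then show ?thesis by (simp add: l_def height_eq_power[OF i(1)])
  qed
  have "dyadic j (c2 + height n i)"
    using small by (intro dyadic_add dyadic_c) (auto simp: height_eq_power[OF i(1)] intro!: dyadic_power)
  then have x2: "x2 = c2 + height n i"
    unfolding x2_def using child_bounds(3,4)[OF \<omega>0] i side_le_l
    by (intro dyadic_floor_eqI) (auto simp: l_def)
  obtain k p where kp: "k \<le> rows n" "p < row_card n k" "\<omega> n = digit n k p"
    using codesD[OF \<omega>(1), of n] by (rule digits_cases)
  have cb: "c2 + height n k \<le> point \<omega> $ 2" "point \<omega> $ 2 < c2 + height n k + side (Suc n)"
    using child_bounds(3,4)[OF \<omega>(1) prefix_eq[OF \<omega>]] kp by auto
  have pt: "c2 + height n i - l \<le> point \<omega> $ 2" "point \<omega> $ 2 < c2 + height n i + 2 * l"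
    using \<omega>(2) unfolding mem_triple x2 by auto
  have s: "8 * side (Suc n) \<le> height n i" using gap_le_height[OF i(1,2)] gap_ge[of n i] by linarith
  have "k = i"
  proof (rule ccontr)
    assume "k \<noteq> i"
    then consider "k = 0" | "0 < k" "k < i" | "i < k" using kp by linarith
    then show False
    proof cases
      case 1
      then show False using cb pt h s l_pos by simp
    next
      case 2
      then show False using height_less[of k i n] cb pt h height_pos[OF i(1), of n] by linarith
    next
      case 3
      then show False using height_less[of i k n] i cb pt h s height_pos[OF i(1), of n] by linarith
    qed
  qed
  then show ?thesis using kp by simp
qed

text \<open>The first summand covers scales where one row is visible. The second is the single scale
  equal to the satellite height: the square stands on the light row and its triple also meets the
  centre row. The third covers the coarser scales, where the square rests on the centre row; for a
  point of the centre row these end at the lowest satellite height.\<close>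

lemma jones_term_le:
  assumes i: "i \<le> rows n" "\<omega>0 n $ 2 = height n i"
  shows "ennreal ((beta2 mu (triple (dyadic_square_at j (point \<omega>0))))\<^sup>2) *
      (ennreal l / emeasure mu (dyadic_square_at j (point \<omega>0)))
      \<le> ennreal ((1/2) ^ (b0 + n) * (side (Suc n) / l / 4 + (if j = side_exp n + 2 * i then 128 else 0)
          + (if j \<le> side_exp n + 2 * rows n then 128 * (1/4) ^ (b0 + n) else 0)))"
    (is "?t \<le> ennreal (?b * (?A + ?B + ?C))")
proof -
  have nn: "0 \<le> ?b" "0 \<le> ?A" "0 \<le> ?B" "0 \<le> ?C" using l_pos by (auto simp: less_imp_le)
  note cb = child_bounds(3,4)[OF \<omega>0 refl, unfolded i(2)]
  have rows_pos: "0 < rows n" by (simp add: rows_def)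
  have A: ?thesis if "\<And>\<omega>. \<omega> \<in> codes \<Longrightarrow> point \<omega> \<in> triple (dyadic_square_at j (point \<omega>0)) \<Longrightarrow> \<omega> n $ 2 = \<omega>0 n $ 2"
  proof -
    have "?t \<le> ennreal (?b * (side (Suc n) / l) / 4)" by (rule jones_term_same_row) (rule that)
    also have "?b * (side (Suc n) / l) / 4 = ?b * ?A" by simp
    also have "?b * ?A \<le> ?b * (?A + ?B + ?C)" using nn by (intro mult_left_mono) auto
    finally show ?thesis using ennreal_leI by simp
  qed
  have C: ?thesis if last: "j \<le> side_exp n + 2 * rows n" and x2: "x2 = c2"
  proof -
    have h: "height n (rows n) \<le> l"
      unfolding height_eq_power[OF rows_pos] l_def using last by (intro power_decreasing) auto
    have "l * row_density n 0 \<le> measure mu (dyadic_square_at j (point \<omega>0))"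
    proof (rule measure_row_ge)
      fix y :: "real^2"
      assume "x1 \<le> y $ 1" "y $ 1 < x1 + l" "c2 + height n 0 \<le> y $ 2" "y $ 2 < c2 + height n 0 + side (Suc n)"
      then show "y \<in> dyadic_square_at j (point \<omega>0)"
        using x2 side_le_l unfolding mem_square height_0 by linarith
    qed (auto simp: l_ge_last_height_bounds[OF h])
    then have m: "2 ^ (b0 + n) * l \<le> measure mu (dyadic_square_at j (point \<omega>0))"
      by (simp add: row_density_def mult.commute)
    have "?t \<le> ennreal (128 * (1/4) ^ (b0 + n) / 2 ^ (b0 + n))"
      using x2 l_pos by (intro jones_term_centre_line[OF h _ m]) auto
    also have "128 * (1/4) ^ (b0 + n) / 2 ^ (b0 + n) = ?b * ?C" using last by (simp add: power_one_over)
    also have "?b * ?C \<le> ?b * (?A + ?B + ?C)" using nn by (intro mult_left_mono) auto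
    finally show ?thesis using ennreal_leI by simp
  qed
  show ?thesis
  proof (cases "i = 0")
    case True
    have x2: "x2 = c2"
      unfolding x2_def using cb True side_le_l dyadic_c by (intro dyadic_floor_eqI) (auto simp: l_def)
    show ?thesis
    proof (cases "j \<le> side_exp n + 2 * rows n")
      case True
      then show ?thesis using C x2 by blast
    next
      case False
      then have "(1/2::real) ^ j \<le> (1/2) ^ Suc (side_exp n + 2 * rows n)" by (intro power_decreasing) auto
      then have h: "2 * l \<le> height n (rows n)" by (simp add: l_def height_eq_power[OF rows_pos])
      show ?thesis
      proof (rule A)
        fix \<omega> assume \<omega>: "\<omega> \<in> codes" "point \<omega> \<in> triple (dyadic_square_at j (point \<omega>0))"
        obtain k p where kp: "k \<le> rows n" "p < row_card n k" "\<omega> n = digit n k p"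
          using codesD[OF \<omega>(1), of n] by (rule digits_cases)
        have "c2 + height n k \<le> point \<omega> $ 2"
          using child_bounds(3)[OF \<omega>(1) prefix_eq[OF \<omega>]] kp by auto
        moreover have "point \<omega> $ 2 < c2 + 2 * l" using \<omega>(2) unfolding mem_triple x2 by auto
        ultimately have "height n k < height n (rows n)" using h by linarith
        then have "k = 0" using height_antimono[of k "rows n" n] kp by (cases "k = 0") auto
        then show "\<omega> n $ 2 = \<omega>0 n $ 2" using kp i \<open>i = 0\<close> by simp
      qed
    qed
  next
    case False
    then have i0: "0 < i" by simp
    have s: "side (Suc n) \<le> height n i"
      using gap_le_height[OF i0 i(1)] gap_ge[of n i] side_pos[of "Suc n"] by linarith
    consider "side_exp n + 2 * i < j" | "j = side_exp n + 2 * i" | "j < side_exp n + 2 * i" by linarith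
    then show ?thesis
    proof cases
      case 1
      then show ?thesis using A same_row_of_satellite[OF i0 i 1] i by simp
    next
      case 2
      then have hl: "height n i = l" by (simp add: l_def height_eq_power[OF i0])
      then have h: "height n (rows n) \<le> l" using height_antimono[OF i0 i(1), of n] by simp
      have x2: "x2 = c2 + l"
        unfolding x2_def using cb hl side_le_l dyadic_c dyadic_l
        by (intro dyadic_floor_eqI dyadic_add) (auto simp: l_def)
      have "l * row_density n i \<le> measure mu (dyadic_square_at j (point \<omega>0))"
      proof (rule measure_row_ge)
        fix y :: "real^2"
        assume "x1 \<le> y $ 1" "y $ 1 < x1 + l" "c2 + height n i \<le> y $ 2" "y $ 2 < c2 + height n i + side (Suc n)"
        then show "y \<in> dyadic_square_at j (point \<omega>0)"
          using x2 side_le_l unfolding mem_square hl by linarith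
      qed (auto simp: l_ge_last_height_bounds[OF h] i)
      then have m: "(1/2) ^ (b0 + n) * l \<le> measure mu (dyadic_square_at j (point \<omega>0))"
        using i0 by (simp add: row_density_def mult.commute)
      have "?t \<le> ennreal (128 * (1/4) ^ (b0 + n) / (1/2) ^ (b0 + n))"
        using x2 by (intro jones_term_centre_line[OF h _ m]) auto
      also have "128 * (1/4) ^ (b0 + n) / (1/2) ^ (b0 + n) = ?b * ?B"
      proof -
        have "(1/4::real) ^ (b0 + n) = (1/2) ^ (b0 + n) * (1/2) ^ (b0 + n)" by (simp flip: power_mult_distrib)
        then show ?thesis using 2 by simp
      qed
      also have "?b * ?B \<le> ?b * (?A + ?B + ?C)" using nn by (intro mult_left_mono) auto
      finally show ?thesis using ennreal_leI by simp
    next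
      case 3
      have "(1/2::real) ^ (side_exp n + 2 * i) * 2 \<le> (1/2) ^ j"
        using power_decreasing[of j "side_exp n + 2 * i - 1" "1/2::real"] 3
        by (cases "side_exp n + 2 * i") auto
      then have "2 * height n i \<le> l" by (simp add: l_def height_eq_power[OF i0])
      then have x2: "x2 = c2"
        unfolding x2_def using cb s height_pos[OF i0, of n] dyadic_c
        by (intro dyadic_floor_eqI) (auto simp: l_def)
      have "2 * i \<le> 2 * rows n" using i by simp
      then have "j \<le> side_exp n + 2 * rows n" using 3 by linarith
      then show ?thesis using C x2 by blast
    qed
  qed
qed

text \<open>At half the height of the satellite, the triple containing the ball sees only that
  row.\<close>

lemma measure_ball_satellite_le:
  assumes i: "0 < i" "i \<le> rows n" "\<omega>0 n $ 2 = height n i" and j': "j = Suc (side_exp n + 2 * i)"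
  shows "measure mu (ball (point \<omega>0) l) \<le> 3 * l * (1/2) ^ (b0 + n)"
proof -
  have "height n i = 2 * l" by (simp add: l_def height_eq_power[OF i(1)] j')
  then have g: "gap n i \<le> l" using gap_le_height[OF i(1,2)] by linarith
  have sub: "ball (point \<omega>0) l \<subseteq> triple (dyadic_square_at j (point \<omega>0))"
  proof
    fix y assume "y \<in> ball (point \<omega>0) l"
    then have "dist (point \<omega>0) y < l" by simp
    then have "dist (point \<omega>0 $ k) (y $ k) < l" for k
      using dist_vec_nth_le[of "point \<omega>0" k y] by (rule le_less_trans[rotated])
    from this[of 1] this[of 2] show "y \<in> triple (dyadic_square_at j (point \<omega>0))"
      using point_in_square unfolding mem_triple dist_real_def by linarith
  qed
  have "measure mu (ball (point \<omega>0) l) = measure code_measure {\<omega> \<in> codes. point \<omega> \<in> ball (point \<omega>0) l}"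
    by (intro measure_mu) auto
  also have "\<dots> \<le> measure code_measure
      {\<omega> \<in> codes. point \<omega> \<in> triple (dyadic_square_at j (point \<omega>0)) \<and> \<omega> n $ 2 = height n i}"
    using sub same_row_of_satellite[OF i]  j'
    by (intro codes.finite_measure_mono measure_triple_row_le i g) auto
  also have "\<dots> \<le> 3 * l * row_density n i" by (intro measure_triple_row_le i g)
  finally show ?thesis using i by (simp add: row_density_def)
qed

end

section \<open>Summation over the generations\<close>

definition jones_term :: "nat \<Rightarrow> real^2 \<Rightarrow> ennreal" where
  "jones_term j x = ennreal ((beta2 mu (triple (dyadic_square_at j x)))\<^sup>2) *
      (ennreal ((1/2) ^ j) / emeasure mu (dyadic_square_at j x))"

text \<open>385 = 1 + 128 + 256: a geometric series, one exceptional scale, and at most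
  \<open>2 * 4 ^ (b0 + n)\<close> scales contributing \<open>128 * (1/4) ^ (b0 + n)\<close>
  each.\<close>

lemma jones_generation_sum_le:
  assumes "\<omega> \<in> codes"
  shows "(\<Sum>j\<in>{side_exp n<..side_exp (Suc n)}. jones_term j (point \<omega>)) \<le> ennreal (385 * (1/2) ^ (b0 + n))"
proof -
  obtain i p where ip: "i \<le> rows n" "p < row_card n i" "\<omega> n = digit n i p"
    using codesD[OF assms, of n] by (rule digits_cases)
  define I where "I = {side_exp n<..side_exp (Suc n)}"
  define B where "B j = (if j = side_exp n + 2 * i then 128 else 0 :: real)" for j
  define C where "C j = (if j \<le> side_exp n + 2 * rows n then 128 * (1/4) ^ (b0 + n) else 0 :: real)" for j
  have nn: "0 \<le> B j" "0 \<le> C j" for j by (simp_all add: B_def C_def)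
  have "(\<Sum>j\<in>I. jones_term j (point \<omega>))
      \<le> (\<Sum>j\<in>I. ennreal ((1/2) ^ (b0 + n) * (side (Suc n) / (1/2) ^ j / 4 + B j + C j)))"
    unfolding jones_term_def B_def C_def
    by (intro sum_mono jones_term_le assms ip) (use ip in \<open>auto simp: I_def\<close>)
  also have "\<dots> = ennreal (\<Sum>j\<in>I. (1/2) ^ (b0 + n) * (side (Suc n) / (1/2) ^ j / 4 + B j + C j))"
    using nn by (intro sum_ennreal mult_nonneg_nonneg add_nonneg_nonneg) (auto simp: less_imp_le)
  also have "(\<Sum>j\<in>I. (1/2) ^ (b0 + n) * (side (Suc n) / (1/2) ^ j / 4 + B j + C j))
      = (1/2) ^ (b0 + n) * ((\<Sum>j\<in>I. side (Suc n) / (1/2) ^ j / 4) + (\<Sum>j\<in>I. B j) + (\<Sum>j\<in>I. C j))"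
    by (simp only: sum_distrib_left[symmetric] sum.distrib)
  also have "\<dots> \<le> (1/2) ^ (b0 + n) * (1 + 128 + 256)"
  proof (intro mult_left_mono add_mono)
    have "(\<Sum>j\<in>I. side (Suc n) / (1/2) ^ j / 4) = (\<Sum>j\<in>I. (1/2) ^ (side_exp (Suc n) - j)) / 4"
      unfolding sum_divide_distrib
      by (intro sum.cong) (auto simp: side_def I_def power_diff)
    also have "\<dots> \<le> 1" using sum_powers_le_2[where a = "side_exp n" and b = "side_exp (Suc n)"] by (simp add: I_def)
    finally show "(\<Sum>j\<in>I. side (Suc n) / (1/2) ^ j / 4) \<le> 1" .
    have "(\<Sum>j\<in>I. B j) = (if side_exp n + 2 * i \<in> I then 128 else 0)"
      unfolding B_def by (simp add: I_def)
    then show "(\<Sum>j\<in>I. B j) \<le> 128" by simp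
    have "(\<Sum>j\<in>I. C j) = (\<Sum>j\<in>I \<inter> {..side_exp n + 2 * rows n}. 128 * (1/4) ^ (b0 + n))"
      unfolding C_def by (subst sum.inter_restrict) (auto simp: I_def)
    also have "\<dots> = real (card (I \<inter> {..side_exp n + 2 * rows n})) * (128 * (1/4) ^ (b0 + n))" by simp
    also have "\<dots> \<le> real (2 * rows n) * (128 * (1/4) ^ (b0 + n))"
    proof (intro mult_right_mono of_nat_mono)
      have "card (I \<inter> {..side_exp n + 2 * rows n}) \<le> card {side_exp n<..side_exp n + 2 * rows n}"
        by (intro card_mono) (auto simp: I_def)
      then show "card (I \<inter> {..side_exp n + 2 * rows n}) \<le> 2 * rows n" by simp
    qed auto
    also have "\<dots> = 256" by (simp add: rows_def power_one_over)
    finally show "(\<Sum>j\<in>I. C j) \<le> 256" .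
  qed auto
  finally show ?thesis by (simp add: I_def mult.commute ennreal_leI)
qed

text \<open>At scales not below \<open>side 0\<close> the dyadic square has full mass, and
  everything lies within \<open>side 0\<close> of the bottom edge.\<close>

lemma jones_initial_term_le:
  assumes "\<omega> \<in> codes" "j \<le> b0 + 1"
  shows "jones_term j (point \<omega>) \<le> ennreal ((1/4) ^ (b0 + 1) * 2 ^ j)"
proof -
  have s: "side 0 \<le> (1/2) ^ j" unfolding side_def using assms by (intro power_decreasing) auto
  have b: "0 \<le> point \<omega>' $ k" "point \<omega>' $ k < side 0" if "\<omega>' \<in> codes" for \<omega>' k
    using point_bounds[OF that, where n = 0 and k = k] by (simp_all add: corner_def)
  have fl: "dyadic_floor j (point \<omega> $ k) = 0" for k
    using b[OF assms(1)] s by (intro dyadic_floor_eqI) (auto intro: less_le_trans)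
  have "{\<omega>' \<in> codes. point \<omega>' \<in> dyadic_square_at j (point \<omega>)} = codes"
    using b(1) less_le_trans[OF b(2) s] by (auto simp: mem_dyadic_square_at fl)
  then have m: "1 \<le> measure mu (dyadic_square_at j (point \<omega>))"
    using codes.prob_space by (simp add: measure_mu)
  have int: "(LINT y:triple (dyadic_square_at j (point \<omega>))|mu. (y $ 2 - 0)\<^sup>2)
      \<le> (side 0)\<^sup>2 * measure mu (triple (dyadic_square_at j (point \<omega>)))"
    by (rule set_integral_mu_le) (use b(1) less_imp_le[OF b(2)] in \<open>auto intro!: power_mono\<close>)
  have "jones_term j (point \<omega>) \<le> ennreal ((side 0)\<^sup>2 / ((1/2) ^ j * 1))"
    unfolding jones_term_def
    by (rule jones1_term_le[OF sets_mu mu.finite_measure_axioms int m]) simp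
  also have "(side 0)\<^sup>2 = (1/4) ^ (b0 + 1)"
    by (simp add: side_def power2_eq_square flip: power_mult_distrib)
  also have "(1/4) ^ (b0 + 1) / ((1/2) ^ j * 1) = (1/4::real) ^ (b0 + 1) * 2 ^ j" by (simp add: power_one_over)
  finally show ?thesis .
qed

text \<open>Up to the factor \<open>(1/2) ^ b0\<close>, the initial scales contribute 1 and the
  first \<open>n\<close> generations contribute \<open>770 * (1 - (1/2) ^ n)\<close>, the partial
  sum of a geometric series starting with 385.\<close>

lemma jones_sum_le:
  assumes "\<omega> \<in> codes"
  shows "(\<Sum>j\<le>side_exp n. jones_term j (point \<omega>)) \<le> ennreal ((1/2) ^ b0 * (771 - 770 * (1/2) ^ n))"
proof (induction n)
  case 0
  have "(\<Sum>j\<le>side_exp 0. jones_term j (point \<omega>)) \<le> (\<Sum>j\<le>b0 + 1. ennreal ((1/4) ^ (b0 + 1) * 2 ^ j))"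
    using jones_initial_term_le[OF assms] by (simp only: side_exp.simps) (intro sum_mono, auto)
  also have "\<dots> = ennreal (\<Sum>j\<le>b0 + 1. (1/4) ^ (b0 + 1) * 2 ^ j)" by (intro sum_ennreal) auto
  also have "(\<Sum>j\<le>b0 + 1. (1/4::real) ^ (b0 + 1) * 2 ^ j) = (1/4) ^ (b0 + 1) * (\<Sum>j<b0 + 2. 2 ^ j)"
    by (simp only: sum_distrib_left lessThan_Suc_atMost[symmetric] add_2_eq_Suc' Suc_eq_plus1[symmetric])
  also have "\<dots> = (1/4) ^ (b0 + 1) * (2 ^ (b0 + 2) - 1)" by (subst geometric_sum) auto
  also have "\<dots> \<le> (1/4) ^ (b0 + 1) * 2 ^ (b0 + 2)" by (intro mult_left_mono) auto
  also have "\<dots> = (1/2) ^ b0"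
  proof -
    have "(1/4::real) ^ b0 * 2 ^ b0 = (1/2) ^ b0" by (simp flip: power_mult_distrib)
    then show ?thesis by (simp add: power_add)
  qed
  finally show ?case by (simp add: ennreal_leI)
next
  case (Suc n)
  have "{..side_exp (Suc n)} = {..side_exp n} \<union> {side_exp n<..side_exp (Suc n)}" by auto
  then have "(\<Sum>j\<le>side_exp (Suc n). jones_term j (point \<omega>))
      = (\<Sum>j\<le>side_exp n. jones_term j (point \<omega>)) + (\<Sum>j\<in>{side_exp n<..side_exp (Suc n)}. jones_term j (point \<omega>))"
    by (simp only:) (intro sum.union_disjoint, auto)
  also have "\<dots> \<le> ennreal ((1/2) ^ b0 * (771 - 770 * (1/2) ^ n)) + ennreal (385 * (1/2) ^ (b0 + n))"
    by (intro add_mono Suc.IH jones_generation_sum_le assms)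
  also have "\<dots> = ennreal ((1/2) ^ b0 * (771 - 770 * (1/2) ^ n) + 385 * (1/2) ^ (b0 + n))"
  proof (rule ennreal_plus[symmetric])
    have "(1/2::real) ^ n \<le> 1" by (intro power_le_one) auto
    then show "0 \<le> (1/2::real) ^ b0 * (771 - 770 * (1/2) ^ n)" by (intro mult_nonneg_nonneg) auto
  qed simp
  also have "(1/2::real) ^ b0 * (771 - 770 * (1/2) ^ n) + 385 * (1/2) ^ (b0 + n) = (1/2) ^ b0 * (771 - 770 * (1/2) ^ Suc n)"
    by (simp add: power_add algebra_simps)
  finally show ?case .
qed

lemma jones1_mu_le:
  assumes "\<omega> \<in> codes"
  shows "jones1 mu (point \<omega>) \<le> ennreal (771 * (1/2) ^ b0)"
proof (rule jones1_le)
  fix J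
  have "(\<Sum>j<J. jones_term j (point \<omega>)) \<le> (\<Sum>j\<le>side_exp J. jones_term j (point \<omega>))"
    using le_side_exp[of J] by (intro sum_mono2) auto
  also have "\<dots> \<le> ennreal ((1/2) ^ b0 * (771 - 770 * (1/2) ^ J))" by (rule jones_sum_le[OF assms])
  also have "\<dots> \<le> ennreal (771 * (1/2) ^ b0)"
    by (intro ennreal_leI) (simp add: algebra_simps)
  finally show "(\<Sum>j<J. ennreal ((beta2 mu (triple (dyadic_square_at j (point \<omega>))))\<^sup>2) *
      (ennreal ((1/2) ^ j) / emeasure mu (dyadic_square_at j (point \<omega>)))) \<le> ennreal (771 * (1/2) ^ b0)"
    by (simp add: jones_term_def)
qed

lemma measure_small_ball:
  assumes "\<omega> \<in> codes" "\<omega> n $ 2 \<noteq> 0"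
  shows "\<exists>r>0. r \<le> (1/2) ^ n \<and> measure mu (ball (point \<omega>) r) \<le> 3 * r * (1/2) ^ n"
proof -
  obtain i p where ip: "i \<le> rows n" "p < row_card n i" "\<omega> n = digit n i p"
    using codesD[OF assms(1), of n] by (rule digits_cases)
  have i0: "0 < i" using assms ip by (cases "i = 0") auto
  define j where "j = Suc (side_exp n + 2 * i)"
  have j: "side_exp n < j" "j \<le> side_exp (Suc n)"
    using ip by (auto simp: j_def step_exp_def rows_def)
  have "measure mu (ball (point \<omega>) ((1/2) ^ j)) \<le> 3 * (1/2) ^ j * (1/2) ^ (b0 + n)"
    by (rule measure_ball_satellite_le[OF assms(1) j i0 ip(1)]) (use ip in \<open>auto simp: j_def\<close>)
  also have "\<dots> \<le> 3 * (1/2) ^ j * (1/2) ^ n" by (intro mult_left_mono power_decreasing) auto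
  finally have "measure mu (ball (point \<omega>) ((1/2) ^ j)) \<le> 3 * (1/2) ^ j * (1/2) ^ n" .
  moreover have "(1/2::real) ^ j \<le> (1/2) ^ n"
  proof -
    have "(1/2::real) ^ j \<le> (1/2) ^ side_exp n" using j by (intro power_decreasing) auto
    also have "\<dots> \<le> (1/2) ^ n" using side_le_power by (simp add: side_def)
    finally show ?thesis .
  qed
  ultimately show ?thesis by (intro exI[of _ "(1/2) ^ j"]) auto
qed

section \<open>Vanishing lower density\<close>

text \<open>As the image of a product of finite digit sets this is compact, which settles
  measurability.\<close>

definition satellite_points :: "nat \<Rightarrow> (real^2) set" where
  "satellite_points n = point ` {\<omega> \<in> codes. \<omega> n $ 2 \<noteq> 0}"

lemma satellite_points_borel [measurable]: "satellite_points n \<in> sets borel"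
proof -
  define D where "D = digits(n := {v \<in> digits n. v $ 2 \<noteq> 0})"
  have "{\<omega> \<in> codes. \<omega> n $ 2 \<noteq> 0} = PiE UNIV D"
    by (auto simp: codes_def D_def PiE_iff split: if_splits)
  moreover have "compact (point ` PiE UNIV D)" by (rule compact_point_image) (auto simp: D_def)
  ultimately show ?thesis by (simp add: satellite_points_def borel_compact)
qed

lemma lower_density1_satellite_points:
  assumes "\<exists>\<^sub>\<infinity>n. x \<in> satellite_points n"
  shows "lower_density1 mu x = 0"
proof (rule ccontr)
  assume "lower_density1 mu x \<noteq> 0"
  then have "0 < lower_density1 mu x" by (simp add: zero_less_iff_neq_zero)
  then obtain c where c: "0 < c" "c < lower_density1 mu x" using dense by blast
  then have "\<forall>\<^sub>F r in at_right 0. c < emeasure mu (ball x r) / ennreal (2 * r)"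
    unfolding lower_density1_def by (intro less_LiminfD)
  then obtain e :: real where e: "e > 0" "\<And>r. 0 < r \<Longrightarrow> r < e \<Longrightarrow> c < emeasure mu (ball x r) / ennreal (2 * r)"
    unfolding eventually_at_right_field by auto
  have "c \<noteq> \<top>" using c by (metis not_top_less)
  then obtain c' where c': "c = ennreal c'" "c' > 0" using c by (cases c) auto
  have "min e (c' / 2) > 0" using e c' by simp
  \<comment> \<open>For \<open>n > N\<close> the ball found below has radius less than
    \<open>e\<close> and density quotient at most \<open>3/2 * (1/2) ^ n\<close>, which is below
    \<open>c'\<close>.\<close>
  then obtain N where N: "(1/2) ^ N < min e (c' / 2)"
    using real_arch_pow_inv[of "min e (c' / 2)" "1/2"] by auto
  obtain n where n: "n > N" "x \<in> satellite_points n" using assms by (auto simp: INFM_nat)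
  then obtain \<omega> where \<omega>: "\<omega> \<in> codes" "\<omega> n $ 2 \<noteq> 0" "x = point \<omega>" by (auto simp: satellite_points_def)
  obtain r where r: "r > 0" "r \<le> (1/2) ^ n" "measure mu (ball x r) \<le> 3 * r * (1/2) ^ n"
    using measure_small_ball[OF \<omega>(1,2)] \<omega>(3) by auto
  have "(1/2::real) ^ n \<le> (1/2) ^ N" using n by (intro power_decreasing) auto
  then have n': "(1/2) ^ n < e" "(1/2) ^ n < c' / 2" using N by linarith+
  have "c < emeasure mu (ball x r) / ennreal (2 * r)" using r n' by (intro e) auto
  also have "\<dots> = ennreal (measure mu (ball x r) / (2 * r))"
    using r by (simp add: mu.emeasure_eq_measure divide_ennreal)
  also have "\<dots> \<le> ennreal c'"
  proof (rule ennreal_leI)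
    have "measure mu (ball x r) / (2 * r) \<le> 3 * r * (1/2) ^ n / (2 * r)" using r by (intro divide_right_mono) auto
    also have "\<dots> \<le> c'" using r n' c' by simp
    finally show "measure mu (ball x r) / (2 * r) \<le> c'" .
  qed
  finally show False using c' by simp
qed

text \<open>A point avoiding the satellites from generation \<open>n\<close> on has only centre
  digits there, an event of probability at most \<open>(1/2) ^ k\<close> for every
  \<open>k\<close>.\<close>

lemma AE_satellite_points: "AE x in mu. \<exists>\<^sub>\<infinity>n. x \<in> satellite_points n"
proof -
  have "AE x in mu. \<exists>m\<ge>n. x \<in> satellite_points m" for n
  proof -
    define N where "N = {x. \<forall>m\<ge>n. x \<notin> satellite_points m}"
    have [measurable]: "N \<in> sets borel" unfolding N_def by measurable
    have le: "measure mu N \<le> (1/2) ^ k" for k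
    proof -
      have "measure mu N = measure code_measure {\<omega> \<in> codes. point \<omega> \<in> N}" by (intro measure_mu) simp
      also have "\<dots> \<le> measure code_measure {\<omega> \<in> codes. \<forall>i\<in>{n..<n + k}. \<omega> i $ 2 = 0}"
      proof (rule codes.finite_measure_mono)
        show "{\<omega> \<in> codes. point \<omega> \<in> N} \<subseteq> {\<omega> \<in> codes. \<forall>i\<in>{n..<n + k}. \<omega> i $ 2 = 0}"
          by (auto simp: N_def satellite_points_def)
        have "{\<omega> \<in> codes. \<forall>i\<in>{n..<n + k}. \<omega> i $ 2 = 0} = {\<omega> \<in> codes. \<forall>i\<in>{n..<n + k}. \<omega> i \<in> {v \<in> digits i. v $ 2 = 0}}"
          using codesD by auto
        then show "{\<omega> \<in> codes. \<forall>i\<in>{n..<n + k}. \<omega> i $ 2 = 0} \<in> codes.events"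
          by (simp only:) (intro sets_cylinder, auto)
      qed
      also have "\<dots> = (1/2) ^ k" by (rule measure_central_codes)
      finally show ?thesis .
    qed
    have "(\<lambda>k. (1/2::real) ^ k) \<longlonglongrightarrow> 0" by (intro LIMSEQ_realpow_zero) auto
    then have "measure mu N \<le> 0" by (rule LIMSEQ_le_const) (use le in auto)
    then have "N \<in> null_sets mu"
      by (auto simp: null_sets_def mu.emeasure_eq_measure measure_le_0_iff)
    then show ?thesis by (rule AE_I') (auto simp: N_def)
  qed
  then have "AE x in mu. \<forall>n. \<exists>m\<ge>n. x \<in> satellite_points m" by (subst AE_all_countable) blast
  then show ?thesis by (simp add: INFM_nat_le)
qed

text \<open>The Cantor set is compact, so its complement is an open null set.\<close>

lemma spt_mu_subset: "spt mu \<subseteq> point ` codes"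
proof -
  have cl: "closed (point ` codes)"
    unfolding codes_def by (intro compact_imp_closed compact_point_image) auto
  have "{\<omega> \<in> codes. point \<omega> \<in> - (point ` codes)} = {}" by auto
  moreover have "- (point ` codes) \<in> sets borel" using cl by (simp add: borel_open open_Compl)
  ultimately have "measure mu (- (point ` codes)) = 0" by (simp only: measure_mu measure_empty)
  then have "emeasure mu (- (point ` codes)) = 0" by (simp add: mu.emeasure_eq_measure)
  then show ?thesis using cl by (auto simp: spt_def open_Compl)
qed

lemma point_in_unit_square: "\<omega> \<in> codes \<Longrightarrow> point \<omega> \<in> cbox 0 1"
proof -
  assume \<omega>: "\<omega> \<in> codes"
  have "side 0 \<le> 1" using side_le_power[of 0] by simp
  then have "0 \<le> point \<omega> $ k \<and> point \<omega> $ k \<le> 1" for k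
    using point_bounds[OF \<omega>, where n = 0 and k = k] by (simp add: corner_def)
  then show ?thesis by (simp add: mem_box_cart)
qed

end

theorem theorem1p2:
  fixes \<epsilon> :: real
  assumes "\<epsilon> > 0"
  shows "\<exists>\<mu> :: (real^2) measure.
           radon_measure \<mu> \<and> prob_space \<mu> \<and> spt \<mu> \<subseteq> cbox 0 1 \<and>
           (\<forall>x\<in>spt \<mu>. jones1 \<mu> x \<le> ennreal \<epsilon>) \<and>
           (AE x in \<mu>. lower_density1 \<mu> x = 0) \<and>
           purely_1_unrectifiable \<mu>"
proof -
  \<comment> \<open>771 is the constant in \<open>jones1_mu_le\<close>.\<close>
  obtain b0 where b0: "(1/2) ^ b0 < \<epsilon> / 771"
    using real_arch_pow_inv[of "\<epsilon> / 771" "1/2"] assms by auto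
  interpret satellite_cantor b0 .
  have dens: "AE x in mu. lower_density1 mu x = 0"
    using AE_satellite_points by eventually_elim (rule lower_density1_satellite_points)
  have "jones1 mu x \<le> ennreal \<epsilon>" if x: "x \<in> spt mu" for x
  proof -
    obtain \<omega> where "\<omega> \<in> codes" "x = point \<omega>" using x spt_mu_subset by blast
    then have "jones1 mu x \<le> ennreal (771 * (1/2) ^ b0)" using jones1_mu_le by simp
    also have "\<dots> \<le> ennreal \<epsilon>" using b0 by (intro ennreal_leI) simp
    finally show ?thesis .
  qed
  moreover have "spt mu \<subseteq> cbox 0 1" using spt_mu_subset point_in_unit_square by auto
  ultimately show ?thesis
    using finite_borel_measure_radon[OF sets_mu mu.finite_measure_axioms] mu.prob_space_axioms dens
      lower_density1_zero_imp_purely_1_unrectifiable[OF sets_mu dens]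
    by blast
qed

end
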